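(* Let $(R,\mathfrak m)$ be a local OK domain of prime characteristic $p>0$ and dimension $d$, and let $I_\bullet$ be a $p$-family of $\mathfrak m$-primary ideals of $R$. Then $\operatorname{vol}_R(I_\bullet)>0$ if and only if there exists a power $q_\circ$ of $p$ such that $I_{qq_\circ}\subseteq\mathfrak m^{[q]}$ for all powers $q$ of $p$.
   Context: $p$ prime; $q$ denotes powers $p^e$, $e\ge0$. $I^{[q]}$ is the ideal generated by $\{x^q:x\in I\}$. A $p$-family of ideals is a sequence $\{I_q\}$ indexed by powers of $p$ with $I_q^{[p]}\subseteq I_{pq}$. $\operatorname{vol}_R(I_\bullet)=\lim_{q\to\infty}\ell_R(R/I_q)/q^d$ (this limit exists for $p$-families of $\mathfrak m$-primary ideals in OK domains). OK domain: fix $\mathbf a\in\mathbb R^d$ with $\mathbb Q$-linearly independent coordinates; order $\mathbb Z^d$ by $\mathbf u\le\mathbf v$ iff $\langle\mathbf u,\mathbf a\rangle\le\langle\mathbf v,\mathbf a\rangle$. A valuation $\nu:\mathbb F^\times\to\mathbb Z^d$ (surjective homomorphism, $\nu(x+y)\ge\min\{\nu(x),\nu(y)\}$ when $x,y,x+y\neq 0$) on the fraction field $\mathbb F$ of a $d$-dimensional local domain $(D,\mathfrak m,\Bbbk)$, with $\mathbb F_{\ge\mathbf u}=\{0\}\cup\{x:\nu(x)\ge\mathbf u\}$, valuation ring $V=\mathbb F_{\ge\mathbf 0}$ with maximal ideal $\mathfrak m_V$ and residue field $\Bbbk_V$, is OK relative to $D$ if (i) $D\subseteq V$, $\mathfrak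 m=\mathfrak m_V\cap D$; (ii) $\langle\mathbf u,\mathbf a\rangle>0$ for every nonzero $\mathbf u$ in the closed convex cone generated by $\nu(D\setminus0)$; (iii) $[\Bbbk_V:\Bbbk]<\infty$; (iv) there is $\mathbf v\in\mathbb Z^d$ with $D\cap\mathbb F_{\ge n\mathbf v}\subseteq\mathfrak m^n$ for all $n\ge0$. $D$ is OK if such $\nu$ exists. *)

theory Defs
  imports Complex_Main "HOL-Computational_Algebra.Fraction_Field" "HOL-Computational_Algebra.Primes"
begin

definition is_ideal :: "'a::comm_ring_1 set \<Rightarrow> bool" where
  "is_ideal I \<longleftrightarrow> 0 \<in> I \<and> (\<forall>x\<in>I. \<forall>y\<in>I. x + y \<in> I) \<and> (\<forall>r. \<forall>x\<in>I. r * x \<in> I)"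

definition ideal_gen :: "'a::comm_ring_1 set \<Rightarrow> 'a set" where
  "ideal_gen S = {x. \<exists>F c. finite F \<and> F \<subseteq> S \<and> x = (\<Sum>s\<in>F. c s * s)}"

definition ideal_prod :: "'a::comm_ring_1 set \<Rightarrow> 'a set \<Rightarrow> 'a set" where
  "ideal_prod I J = ideal_gen {x * y | x y. x \<in> I \<and> y \<in> J}"

fun ideal_pow :: "'a::comm_ring_1 set \<Rightarrow> nat \<Rightarrow> 'a set" where
  "ideal_pow I 0 = UNIV"
| "ideal_pow I (Suc n) = ideal_prod I (ideal_pow I n)"

definition frob_pow :: "nat \<Rightarrow> 'a::comm_ring_1 set \<Rightarrow> 'a set" where
  "frob_pow q I = ideal_gen {x ^ q | x. x \<in> I}"

definition prime_ideal :: "'a::comm_ring_1 set \<Rightarrow> bool" where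
  "prime_ideal P \<longleftrightarrow> is_ideal P \<and> P \<noteq> UNIV \<and> (\<forall>a b. a * b \<in> P \<longrightarrow> a \<in> P \<or> b \<in> P)"

definition maximal_ideal :: "'a::comm_ring_1 set \<Rightarrow> bool" where
  "maximal_ideal M \<longleftrightarrow> is_ideal M \<and> M \<noteq> UNIV \<and>
     (\<forall>J. is_ideal J \<and> M \<subseteq> J \<longrightarrow> J = M \<or> J = UNIV)"

definition noetherian_ring :: "'a::comm_ring_1 itself \<Rightarrow> bool" where
  "noetherian_ring _ \<longleftrightarrow> (\<forall>I::'a set. is_ideal I \<longrightarrow> (\<exists>F. finite F \<and> I = ideal_gen F))"

definition local_ring_with_max :: "'a::comm_ring_1 set \<Rightarrow> bool" where
  "local_ring_with_max m \<longleftrightarrow> noetherian_ring TYPE('a) \<and> maximal_ideal m \<and>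
     (\<forall>M. maximal_ideal M \<longrightarrow> M = m)"

definition has_prime_chain :: "'a::comm_ring_1 itself \<Rightarrow> nat \<Rightarrow> bool" where
  "has_prime_chain _ n \<longleftrightarrow> (\<exists>P :: nat \<Rightarrow> 'a set. (\<forall>i\<le>n. prime_ideal (P i)) \<and> (\<forall>i<n. P i \<subset> P (Suc i)))"

definition krull_dim_eq :: "'a::comm_ring_1 itself \<Rightarrow> nat \<Rightarrow> bool" where
  "krull_dim_eq T d \<longleftrightarrow> has_prime_chain T d \<and> \<not> has_prime_chain T (Suc d)"

definition radical :: "'a::comm_ring_1 set \<Rightarrow> 'a set" where
  "radical I = {x. \<exists>n. x ^ n \<in> I}"

definition primary_ideal :: "'a::comm_ring_1 set \<Rightarrow> bool" where
  "primary_ideal I \<longleftrightarrow> is_ideal I \<and> I \<noteq> UNIV \<and> (\<forall>a b. a * b \<in> I \<and> a \<notin> I \<longrightarrow> (\<exists>n. b ^ n \<in> I))"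

definition m_primary :: "'a::comm_ring_1 set \<Rightarrow> 'a set \<Rightarrow> bool" where
  "m_primary m I \<longleftrightarrow> primary_ideal I \<and> radical I = m"

text \<open>Length \<open>\<ell>_R(R/I)\<close>: the supremum of lengths of strict chains of ideals from \<open>I\<close> to \<open>R\<close>
  (submodules of \<open>R/I\<close> correspond to ideals containing \<open>I\<close>; length of a module = maximal
  length of a strict chain of submodules).\<close>
definition ideal_chain_from :: "'a::comm_ring_1 set \<Rightarrow> nat \<Rightarrow> bool" where
  "ideal_chain_from I n \<longleftrightarrow> (\<exists>J :: nat \<Rightarrow> 'a set. J 0 = I \<and> J n = UNIV \<and>
      (\<forall>i\<le>n. is_ideal (J i)) \<and> (\<forall>i<n. J i \<subset> J (Suc i)))"

definition colength :: "'a::comm_ring_1 set \<Rightarrow> nat" where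
  "colength I = Sup {n. ideal_chain_from I n}"

text \<open>A p-family indexed by exponents: \<open>I e\<close> stands for \<open>I_{p^e}\<close>.\<close>
definition p_family :: "nat \<Rightarrow> (nat \<Rightarrow> 'a::comm_ring_1 set) \<Rightarrow> bool" where
  "p_family p I \<longleftrightarrow> (\<forall>e. is_ideal (I e)) \<and> (\<forall>e. frob_pow p (I e) \<subseteq> I (Suc e))"

definition volume :: "nat \<Rightarrow> nat \<Rightarrow> (nat \<Rightarrow> 'a::comm_ring_1 set) \<Rightarrow> real" where
  "volume p d I = lim (\<lambda>e. real (colength (I e)) / real (p ^ e) ^ d)"

definition zvec :: "nat \<Rightarrow> (nat \<Rightarrow> int) set" where
  "zvec d = {u. \<forall>i\<ge>d. u i = 0}"

definition pair_a :: "nat \<Rightarrow> (nat \<Rightarrow> real) \<Rightarrow> (nat \<Rightarrow> int) \<Rightarrow> real" where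
  "pair_a d a u = (\<Sum>i<d. real_of_int (u i) * a i)"

definition rat_lin_indep :: "nat \<Rightarrow> (nat \<Rightarrow> real) \<Rightarrow> bool" where
  "rat_lin_indep d a \<longleftrightarrow> (\<forall>c :: nat \<Rightarrow> rat. (\<Sum>i<d. of_rat (c i) * a i) = 0 \<longrightarrow> (\<forall>i<d. c i = 0))"

definition is_valuation :: "nat \<Rightarrow> (nat \<Rightarrow> real) \<Rightarrow> ('a::field \<Rightarrow> (nat \<Rightarrow> int)) \<Rightarrow> bool" where
  "is_valuation d a \<nu> \<longleftrightarrow>
     \<nu> ` {x. x \<noteq> 0} = zvec d \<and>
     (\<forall>x y. x \<noteq> 0 \<longrightarrow> y \<noteq> 0 \<longrightarrow> \<nu> (x * y) = (\<lambda>i. \<nu> x i + \<nu> y i)) \<and>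
     (\<forall>x y. x \<noteq> 0 \<longrightarrow> y \<noteq> 0 \<longrightarrow> x + y \<noteq> 0 \<longrightarrow>
        pair_a d a (\<nu> (x + y)) \<ge> min (pair_a d a (\<nu> x)) (pair_a d a (\<nu> y)))"

definition val_ge :: "nat \<Rightarrow> (nat \<Rightarrow> real) \<Rightarrow> ('a::field \<Rightarrow> (nat \<Rightarrow> int)) \<Rightarrow> (nat \<Rightarrow> int) \<Rightarrow> 'a set" where
  "val_ge d a \<nu> u = {0} \<union> {x. x \<noteq> 0 \<and> pair_a d a (\<nu> x) \<ge> pair_a d a u}"

definition val_ring :: "nat \<Rightarrow> (nat \<Rightarrow> real) \<Rightarrow> ('a::field \<Rightarrow> (nat \<Rightarrow> int)) \<Rightarrow> 'a set" where
  "val_ring d a \<nu> = val_ge d a \<nu> (\<lambda>_. 0)"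

definition val_max :: "nat \<Rightarrow> (nat \<Rightarrow> real) \<Rightarrow> ('a::field \<Rightarrow> (nat \<Rightarrow> int)) \<Rightarrow> 'a set" where
  "val_max d a \<nu> = {0} \<union> {x. x \<noteq> 0 \<and> pair_a d a (\<nu> x) > 0}"

text \<open>Closed convex cone in \<open>\<real>^d\<close> generated by a set of integer vectors; closure expressed
  by limits of sequences (componentwise convergence = Euclidean convergence in \<open>\<real>^d\<close>).\<close>
definition cone_gen :: "(nat \<Rightarrow> int) set \<Rightarrow> (nat \<Rightarrow> real) set" where
  "cone_gen S = {u. \<exists>F c. finite F \<and> F \<subseteq> S \<and> (\<forall>v\<in>F. c v \<ge> (0::real)) \<and>
                     u = (\<lambda>i. \<Sum>v\<in>F. c v * real_of_int (v i))}"

definition closed_cone_gen :: "(nat \<Rightarrow> int) set \<Rightarrow> (nat \<Rightarrow> real) set" where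
  "closed_cone_gen S = {u. \<exists>X. (\<forall>k. X k \<in> cone_gen S) \<and> (\<forall>i. (\<lambda>k. X k i) \<longlonglongrightarrow> u i)}"

definition pair_real :: "nat \<Rightarrow> (nat \<Rightarrow> real) \<Rightarrow> (nat \<Rightarrow> real) \<Rightarrow> real" where
  "pair_real d a u = (\<Sum>i<d. u i * a i)"

text \<open>OK valuation relative to the local domain with maximal ideal \<open>m\<close>; \<open>D\<close> embeds in its
  fraction field via \<open>x \<mapsto> Fract x 1\<close>.  Condition (iii) \<open>[\<kappa>_V:\<kappa>] < \<infinity>\<close> is written out as:
  \<open>V/\<mm>_V\<close> is spanned over (the image of) \<open>D\<close> by finitely many elements.\<close>
definition ok_valuation :: "nat \<Rightarrow> (nat \<Rightarrow> real) \<Rightarrow> 'a::idom set \<Rightarrow> ('a fract \<Rightarrow> (nat \<Rightarrow> int)) \<Rightarrow> bool" where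
  "ok_valuation d a m \<nu> \<longleftrightarrow>
     is_valuation d a \<nu> \<and>
     (\<forall>x. Fract x 1 \<in> val_ring d a \<nu>) \<and>
     (\<forall>x. x \<in> m \<longleftrightarrow> Fract x 1 \<in> val_max d a \<nu>) \<and>
     (\<forall>u\<in>closed_cone_gen (\<nu> ` {Fract x 1 | x. x \<noteq> 0}). u \<noteq> (\<lambda>_. 0) \<longrightarrow> pair_real d a u > 0) \<and>
     (\<exists>B. finite B \<and> B \<subseteq> val_ring d a \<nu> \<and>
        (\<forall>y\<in>val_ring d a \<nu>. \<exists>c. y - (\<Sum>b\<in>B. Fract (c b) 1 * b) \<in> val_max d a \<nu>)) \<and>
     (\<exists>v\<in>zvec d. \<forall>n x. Fract x 1 \<in> val_ge d a \<nu> (\<lambda>i. int n * v i) \<longrightarrow> x \<in> ideal_pow m n)"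

definition ok_domain :: "nat \<Rightarrow> (nat \<Rightarrow> real) \<Rightarrow> 'a::idom set \<Rightarrow> bool" where
  "ok_domain d a m \<longleftrightarrow> (\<exists>\<nu>. ok_valuation d a m \<nu>)"

end

theory Submission
  imports Defs
begin

text \<open>
  Write \<open>S = \<nu>(R - 0)\<close>, \<open>T\<^sub>q = \<nu>(I\<^sub>q - 0)\<close> and \<open>L u = \<langle>u, a\<rangle>\<close>. Up to \<open>O(q\<^sup>d\<^sup>-\<^sup>1)\<close> the colength of \<open>I\<^sub>q\<close> is
  \<open>[\<kappa>\<^sub>V : \<kappa>]\<close> times the number of points of \<open>S - T\<^sub>q\<close>, all of which satisfy \<open>L u < c q\<close> for a fixed \<open>c\<close>.
  Since \<open>S\<close> generates \<open>\<int>\<^sup>d\<close>, there is \<open>b\<close> with \<open>n b + [0, n]\<^sup>d \<subseteq> S\<close> for all \<open>n\<close>; hence every point of \<open>T\<^sub>q\<close>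
  produces a full box of \<open>n\<^sup>d\<close> points of \<open>T\<close> at level \<open>n q\<close>, and the normalised counts increase up to an error
  \<open>O(1/q)\<close>. So the volume exists as a limit.

  If \<open>I\<close> at level \<open>q q\<^sub>0\<close> lies in \<open>m\<^bsup>[q]\<^esup>\<close>, its values are at least \<open>q \<delta>\<close>, so a fixed proportion of \<open>S\<close> is missed and the
  volume is positive. Otherwise, as all elements of value at least \<open>q \<kappa>\<close> lie in \<open>m\<^bsup>[q]\<^esup>\<close>, for every \<open>q\<^sub>0\<close> there are \<open>q\<close> and \<open>w\<close> in
  \<open>T\<close> at level \<open>q q\<^sub>0\<close> with \<open>L w < q \<kappa>\<close>. The translates of \<open>S\<close> by multiples of \<open>w\<close> leave out only a slab of relative
  width \<open>\<kappa>/q\<^sub>0\<close>, and the volume vanishes.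
\<close>

subsection \<open>Counting lattice points\<close>

lemma pair_a_add: "pair_a d a (\<lambda>i. u i + v i) = pair_a d a u + pair_a d a v"
  by (simp add: pair_a_def distrib_right sum.distrib)

lemma pair_a_scale: "pair_a d a (\<lambda>i. k * u i) = real_of_int k * pair_a d a u"
  by (simp add: pair_a_def sum_distrib_left mult.assoc)

lemma pair_a_zero [simp]: "pair_a d a (\<lambda>_. 0) = 0"
  by (simp add: pair_a_def)

lemma pair_a_upd: "pair_a (Suc n) a (y(n := k)) = pair_a n a y + real_of_int k * a n"
  by (simp add: pair_a_def)

text \<open>Splitting off the last coordinate turns a box of dimension \<open>d + 1\<close> into a
  product. Vectors are functions on all of \<open>nat\<close>; \<open>zvec\<close> keeps the box
  finite by fixing the remaining coordinates at 0.\<close>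

lemma card_zvec_box:
  assumes "finite A"
  shows "finite {u \<in> zvec d. \<forall>i<d. u i \<in> A} \<and> card {u \<in> zvec d. \<forall>i<d. u i \<in> A} = card A ^ d"
proof (induction d)
  case 0
  have "{u \<in> zvec 0. \<forall>i<0. u i \<in> A} = {\<lambda>_. 0}"
    by (auto simp: zvec_def)
  then show ?case by simp
next
  case (Suc d)
  let ?B = "\<lambda>d. {u \<in> zvec d. \<forall>i<d. u i \<in> A}"
  have bij: "bij_betw (\<lambda>(u, k). u(d := k)) (?B d \<times> A) (?B (Suc d))"
    by (rule bij_betw_byWitness[where f' = "\<lambda>u. (u(d := 0), u d)"])
       (auto simp: zvec_def fun_eq_iff less_Suc_eq)
  have "finite (?B d \<times> A)" using Suc assms by simp
  then have "finite (?B (Suc d))" using bij_betw_finite[OF bij] by blast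
  moreover have "card (?B (Suc d)) = card A ^ Suc d"
    using bij_betw_same_card[OF bij] Suc by (simp add: card_cartesian_product mult.commute)
  ultimately show ?case by simp
qed

lemma card_int_interval_le:
  assumes "0 \<le> l"
  shows "finite {k::int. x \<le> real_of_int k \<and> real_of_int k \<le> x + l}"
    and "real (card {k::int. x \<le> real_of_int k \<and> real_of_int k \<le> x + l}) \<le> l + 1"
proof -
  have sub: "{k::int. x \<le> real_of_int k \<and> real_of_int k \<le> x + l} = {\<lceil>x\<rceil>..\<lfloor>x + l\<rfloor>}"
    by (auto simp: ceiling_le_iff le_floor_iff)
  show "finite {k::int. x \<le> real_of_int k \<and> real_of_int k \<le> x + l}"
    unfolding sub by simp
  have "real_of_int (\<lfloor>x + l\<rfloor> + 1 - \<lceil>x\<rceil>) \<le> l + 1"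
    by linarith
  then show "real (card {k::int. x \<le> real_of_int k \<and> real_of_int k \<le> x + l}) \<le> l + 1"
    unfolding sub using assms by (cases "\<lfloor>x + l\<rfloor> + 1 - \<lceil>x\<rceil> \<ge> 0") (simp_all add: algebra_simps)
qed

text \<open>This serves to count the last coordinate \<open>k\<close> of a lattice point once the
  others are fixed: \<open>z\<close> is their share of the functional and \<alpha> the last
  coefficient.\<close>

lemma card_int_slab_le:
  fixes \<alpha> :: real
  assumes "\<alpha> \<noteq> 0" "t \<le> s"
  shows "finite {k::int. t \<le> z + real_of_int k * \<alpha> \<and> z + real_of_int k * \<alpha> < s}"
    and "real (card {k::int. t \<le> z + real_of_int k * \<alpha> \<and> z + real_of_int k * \<alpha> < s}) \<le> (s - t) / \<bar>\<alpha>\<bar> + 1"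
proof -
  let ?A = "{k::int. t \<le> z + real_of_int k * \<alpha> \<and> z + real_of_int k * \<alpha> < s}"
  let ?l = "(s - t) / \<bar>\<alpha>\<bar>"
  have l: "0 \<le> ?l" using assms by simp
  \<comment> \<open>The left end of the interval for \<open>k\<close> comes from \<open>t\<close> or
    from \<open>s\<close>, according to the sign of \<alpha>.\<close>
  obtain x where sub: "?A \<subseteq> {k::int. x \<le> real_of_int k \<and> real_of_int k \<le> x + ?l}"
  proof (cases "\<alpha> > 0")
    case True
    show ?thesis
      by (rule that[of "(t - z) / \<alpha>"]) (use True in \<open>auto simp: field_simps\<close>)
  next
    case False
    show ?thesis
    proof (rule that[of "(s - z) / \<alpha>"], clarify)
      fix k :: int assume k: "t \<le> z + real_of_int k * \<alpha>" "z + real_of_int k * \<alpha> < s"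
      have neg: "\<alpha> < 0" using False assms by simp
      have "(s - z) / \<alpha> + ?l = (t - z) / \<alpha>" using neg by (simp add: field_simps)
      moreover have "(s - z) / \<alpha> \<le> real_of_int k" "real_of_int k \<le> (t - z) / \<alpha>"
        using k neg by (simp_all add: neg_divide_le_eq neg_le_divide_eq)
      ultimately show "(s - z) / \<alpha> \<le> real_of_int k \<and> real_of_int k \<le> (s - z) / \<alpha> + ?l" by simp
    qed
  qed
  show "finite ?A" by (rule finite_subset[OF sub card_int_interval_le(1)[OF l]])
  show "real (card ?A) \<le> ?l + 1"
    using card_mono[OF card_int_interval_le(1)[OF l] sub] card_int_interval_le(2)[OF l, of x] by linarith
qed

text \<open>These are the properties of the value semigroup on which the counting rests.
  \<open>S_diff\<close> says that \<open>S\<close> generates the lattice, with unit vectors as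
  differences, and \<open>S_bound\<close> is a uniform form of the positivity of \<open>a\<close> on
  the closed cone.\<close>

locale weighted_monoid =
  fixes d :: nat and a :: "nat \<Rightarrow> real" and S :: "(nat \<Rightarrow> int) set" and \<epsilon> :: real
  assumes d_pos: "0 < d"
    and last_coord: "a (d - 1) \<noteq> 0"
    and S_sub: "S \<subseteq> zvec d"
    and S_zero: "(\<lambda>_. 0) \<in> S"
    and S_add: "u \<in> S \<Longrightarrow> v \<in> S \<Longrightarrow> (\<lambda>i. u i + v i) \<in> S"
    and S_diff: "i < d \<Longrightarrow> \<exists>s\<in>S. \<exists>s'\<in>S. \<forall>j. s j - s' j = (if j = i then 1 else 0)"
    and eps_pos: "0 < \<epsilon>"
    and S_bound: "u \<in> S \<Longrightarrow> i < d \<Longrightarrow> \<epsilon> * \<bar>real_of_int (u i)\<bar> \<le> pair_a d a u"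
begin

abbreviation L :: "(nat \<Rightarrow> int) \<Rightarrow> real" where "L \<equiv> pair_a d a"

definition cnt :: "(nat \<Rightarrow> int) set \<Rightarrow> real \<Rightarrow> nat" where
  "cnt A t = card {u \<in> A. L u < t}"

lemma L_nonneg: "u \<in> S \<Longrightarrow> 0 \<le> L u"
  using S_bound[OF _ d_pos, of u] eps_pos by (meson abs_ge_zero less_imp_le mult_nonneg_nonneg order_trans)

lemma S_scale: "u \<in> S \<Longrightarrow> (\<lambda>i. int n * u i) \<in> S"
proof (induction n)
  case (Suc n)
  then have "(\<lambda>i. u i + int n * u i) \<in> S" by (intro S_add) auto
  then show ?case by (simp add: algebra_simps)
qed (simp add: S_zero)

lemma S_sum: "finite A \<Longrightarrow> (\<And>j. j \<in> A \<Longrightarrow> f j \<in> S) \<Longrightarrow> (\<lambda>i. \<Sum>j\<in>A. f j i) \<in> S"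
  by (induction A rule: finite_induct) (auto simp: S_zero intro!: S_add)

text \<open>By \<open>S_bound\<close> a point with \<open>L u < c * q\<close> has coordinates
  \<open>O(q)\<close>, which leaves \<open>O(q ^ (d - 1))\<close> choices for the first
  \<open>d - 1\<close> of them; the last one then runs through an interval of length proportional to
  \<open>s - t\<close>.\<close>

lemma slab_count:
  assumes "0 < c"
  obtains K where "0 < K"
    and "\<And>q s t. 1 \<le> q \<Longrightarrow> t \<le> s \<Longrightarrow> s \<le> c * q \<Longrightarrow> finite {u \<in> S. t \<le> L u \<and> L u < s}"
    and "\<And>q s t. 1 \<le> q \<Longrightarrow> t \<le> s \<Longrightarrow> s \<le> c * q \<Longrightarrow>
      real (card {u \<in> S. t \<le> L u \<and> L u < s}) \<le> K * q ^ (d - 1) * (s - t + 1)"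
proof -
  obtain n where d: "d = Suc n" using d_pos by (cases d) auto
  let ?\<alpha> = "\<bar>a n\<bar>"
  have \<alpha>: "a n \<noteq> 0" using last_coord d by simp
  \<comment> \<open>\<open>2 * c / \<epsilon> + 1\<close> bounds the side of the box divided by
    \<open>q\<close>; the maximum lets one constant dominate both terms of
    \<open>(s - t) / \<bar>a n\<bar> + 1\<close>.\<close>
  define K where "K = (2 * c / \<epsilon> + 1) ^ n * max (1 / ?\<alpha>) 1"
  have K0: "K > 0" unfolding K_def using assms eps_pos
    by (auto intro!: mult_pos_pos zero_less_power add_pos_pos divide_pos_pos simp: less_max_iff_disj)
  have main: "finite {u \<in> S. t \<le> L u \<and> L u < s} \<and>
    real (card {u \<in> S. t \<le> L u \<and> L u < s}) \<le> K * q ^ (d - 1) * (s - t + 1)"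
    if q: "1 \<le> q" and ts: "t \<le> s" and sc: "s \<le> c * q" for q s t
  proof -
    let ?E = "{u \<in> S. t \<le> L u \<and> L u < s}"
    define M where "M = \<lfloor>c * q / \<epsilon>\<rfloor>"
    have M0: "M \<ge> 0" using assms q eps_pos unfolding M_def by simp
    let ?B = "{u \<in> zvec n. \<forall>i<n. u i \<in> {-M..M}}"
    let ?I = "\<lambda>y. {k::int. t \<le> pair_a n a y + real_of_int k * a n \<and> pair_a n a y + real_of_int k * a n < s}"
    have sub: "?E \<subseteq> (\<Union>y\<in>?B. (\<lambda>k. y(n := k)) ` ?I y)"
    proof
      fix u assume u: "u \<in> ?E"
      have "u i \<in> {-M..M}" if "i < n" for i
      proof -
        have "\<epsilon> * \<bar>real_of_int (u i)\<bar> \<le> c * q" using S_bound[of u i] u that d sc by auto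
        then have "real_of_int \<bar>u i\<bar> \<le> c * q / \<epsilon>" using eps_pos by (simp add: field_simps)
        then have "\<bar>u i\<bar> \<le> M" unfolding M_def by (simp add: le_floor_iff)
        then show ?thesis by auto
      qed
      then have "u(n := 0) \<in> ?B" using u S_sub d by (auto simp: zvec_def)
      moreover have "u = (u(n := 0))(n := u n)" by auto
      moreover have "u n \<in> ?I (u(n := 0))"
        using u pair_a_upd[of n a "u(n := 0)" "u n"] d by simp
      ultimately show "u \<in> (\<Union>y\<in>?B. (\<lambda>k. y(n := k)) ` ?I y)" by blast
    qed
    have finB: "finite ?B" and cardB: "card ?B = nat (2 * M + 1) ^ n"
      using card_zvec_box[of "{-M..M}" n] by (simp_all add: algebra_simps)
    have finU: "finite (\<Union>y\<in>?B. (\<lambda>k. y(n := k)) ` ?I y)"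
      using finB card_int_slab_le(1)[OF \<alpha> ts] by blast
    have fin: "finite ?E" by (rule finite_subset[OF sub finU])
    have "real (card ?E) \<le> real (card (\<Union>y\<in>?B. (\<lambda>k. y(n := k)) ` ?I y))"
      using card_mono[OF finU sub] by simp
    also have "\<dots> \<le> (\<Sum>y\<in>?B. real (card ((\<lambda>k. y(n := k)) ` ?I y)))"
      unfolding of_nat_sum[symmetric] of_nat_le_iff by (rule card_UN_le[OF finB])
    also have "\<dots> \<le> (\<Sum>y\<in>?B. (s - t) / ?\<alpha> + 1)"
    proof (rule sum_mono)
      fix y
      have "real (card ((\<lambda>k. y(n := k)) ` ?I y)) \<le> real (card (?I y))"
        using card_image_le[OF card_int_slab_le(1)[OF \<alpha> ts]] by simp
      then show "real (card ((\<lambda>k. y(n := k)) ` ?I y)) \<le> (s - t) / ?\<alpha> + 1"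
        using card_int_slab_le(2)[OF \<alpha> ts, of "pair_a n a y"] by linarith
    qed
    also have "\<dots> = real_of_int (2 * M + 1) ^ n * ((s - t) / ?\<alpha> + 1)"
      using cardB M0 by simp
    also have "\<dots> \<le> ((2 * c / \<epsilon> + 1) * q) ^ n * (max (1 / ?\<alpha>) 1 * (s - t + 1))"
    proof (rule mult_mono)
      have "real_of_int M \<le> c * q / \<epsilon>" unfolding M_def by simp
      then have "real_of_int (2 * M + 1) \<le> 2 * (c * q / \<epsilon>) + q"
        using q by simp
      also have "\<dots> = (2 * c / \<epsilon> + 1) * q" by (simp add: algebra_simps)
      finally have "real_of_int (2 * M + 1) \<le> (2 * c / \<epsilon> + 1) * q" .
      then show "real_of_int (2 * M + 1) ^ n \<le> ((2 * c / \<epsilon> + 1) * q) ^ n"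
        using M0 by (intro power_mono) auto
      have "(s - t) * (1 / ?\<alpha>) \<le> (s - t) * max (1 / ?\<alpha>) 1"
        using ts by (intro mult_left_mono) auto
      then show "(s - t) / ?\<alpha> + 1 \<le> max (1 / ?\<alpha>) 1 * (s - t + 1)"
        unfolding distrib_left by (simp add: mult.commute add_mono)
      show "0 \<le> (s - t) / ?\<alpha> + 1" using ts by simp
      show "0 \<le> ((2 * c / \<epsilon> + 1) * q) ^ n" using q assms eps_pos by simp
    qed
    also have "\<dots> = K * q ^ (d - 1) * (s - t + 1)"
      by (simp add: K_def power_mult_distrib d)
    finally show ?thesis using fin by simp
  qed
  show ?thesis
    by (rule that[OF K0]) (use main in \<open>simp_all del: One_nat_def\<close>)
qed

lemma finite_below: "finite {u \<in> S. L u < t}"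
proof -
  \<comment> \<open>With \<open>c = 1\<close> the slab bound asks for \<open>s \<le> q\<close> and
    \<open>1 \<le> q\<close>; both hold for \<open>s = q = max 1 t\<close>.\<close>
  have "finite {u \<in> S. 0 \<le> L u \<and> L u < max 1 t}"
  proof (rule slab_count[of 1])
    fix K :: real
    assume "\<And>q s t. 1 \<le> q \<Longrightarrow> t \<le> s \<Longrightarrow> s \<le> 1 * q \<Longrightarrow> finite {u \<in> S. t \<le> L u \<and> L u < s}"
    from this[of "max 1 t" 0 "max 1 t"] show ?thesis by simp
  qed simp
  moreover have "{u \<in> S. L u < t} \<subseteq> {u \<in> S. 0 \<le> L u \<and> L u < max 1 t}"
    using L_nonneg by auto
  ultimately show ?thesis by (rule rev_finite_subset)
qed

lemma finite_below_sub: "A \<subseteq> S \<Longrightarrow> finite {u \<in> A. L u < t}"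
  by (rule finite_subset[OF _ finite_below]) auto

lemma cnt_slab:
  assumes "A \<subseteq> S" "t \<le> s"
  shows "real (cnt A s) \<le> real (cnt A t) + real (card {u \<in> S. t \<le> L u \<and> L u < s})"
proof -
  have "{u \<in> A. L u < s} \<subseteq> {u \<in> A. L u < t} \<union> {u \<in> S. t \<le> L u \<and> L u < s}"
    using assms by auto
  moreover have fin: "finite {u \<in> S. t \<le> L u \<and> L u < s}"
    by (rule finite_subset[OF _ finite_below[of s]]) auto
  ultimately have "cnt A s \<le> card ({u \<in> A. L u < t} \<union> {u \<in> S. t \<le> L u \<and> L u < s})"
    unfolding cnt_def using finite_below_sub[OF assms(1)] by (intro card_mono) auto
  also have "\<dots> \<le> cnt A t + card {u \<in> S. t \<le> L u \<and> L u < s}"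
    unfolding cnt_def by (rule card_Un_le)
  finally show ?thesis by linarith
qed

lemma cnt_shift: "cnt ((\<lambda>u i. u i + v i) ` A) t = cnt A (t - L v)"
proof -
  have "inj_on (\<lambda>u i. u i + v i) {u \<in> A. L u < t - L v}"
    by (rule inj_onI) (auto simp: fun_eq_iff)
  moreover have "{u \<in> (\<lambda>u i. u i + v i) ` A. L u < t} = (\<lambda>u i. u i + v i) ` {u \<in> A. L u < t - L v}"
    by (auto simp: pair_a_add)
  ultimately show ?thesis by (simp add: cnt_def card_image)
qed

text \<open>With \<open>e\<^sub>i = s\<^sub>i - s'\<^sub>i\<close> and \<open>b = \<Sum> s'\<^sub>i\<close> one has \<open>n b + t = \<Sum> (t\<^sub>i s\<^sub>i + (n - t\<^sub>i) s'\<^sub>i)\<close>.\<close>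

lemma box_in_S:
  "\<exists>b \<beta>. 0 \<le> \<beta> \<and> (\<forall>n t. t \<in> zvec d \<longrightarrow> (\<forall>i<d. t i \<in> {0..<int n}) \<longrightarrow>
     (\<lambda>i. int n * b i + t i) \<in> S \<and> L (\<lambda>i. int n * b i + t i) \<le> real n * \<beta>)"
proof -
  have "\<exists>s s'. \<forall>i<d. s i \<in> S \<and> s' i \<in> S \<and> (\<forall>j. s i j - s' i j = (if j = i then 1 else 0))"
    using S_diff by metis
  then obtain s s' where ss: "\<And>i. i < d \<Longrightarrow> s i \<in> S" "\<And>i. i < d \<Longrightarrow> s' i \<in> S"
    "\<And>i j. i < d \<Longrightarrow> s i j - s' i j = (if j = i then 1 else 0)" by metis
  let ?b = "\<lambda>i. \<Sum>j<d. s' j i"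
  \<comment> \<open>For \<open>0 \<le> t i < n\<close> the value \<open>L t\<close> is at most
    \<open>n\<close> times the sum of the \<open>\<bar>a i\<bar>\<close>, and \<open>n * b\<close>
    contributes \<open>n * L b\<close>.\<close>
  let ?\<beta> = "L ?b + (\<Sum>i<d. \<bar>a i\<bar>)"
  have "?b \<in> S" using ss by (intro S_sum) auto
  then have "0 \<le> ?\<beta>" using L_nonneg by (simp add: sum_nonneg)
  moreover have "(\<lambda>i. int n * ?b i + t i) \<in> S"
    if t: "t \<in> zvec d" "\<forall>i<d. t i \<in> {0..<int n}" for n t
  proof -
    \<comment> \<open>The coefficients \<open>t j\<close> and \<open>n - t j\<close> are
      nonnegative, so the sum stays in the monoid.\<close>
    have "(\<lambda>i. \<Sum>j<d. int (nat (t j)) * s j i + int (n - nat (t j)) * s' j i) \<in> S"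
      using ss by (intro S_sum S_add S_scale) auto
    moreover have "(\<Sum>j<d. int (nat (t j)) * s j i + int (n - nat (t j)) * s' j i) = int n * ?b i + t i" for i
    proof -
      have "(\<Sum>j<d. int (nat (t j)) * s j i + int (n - nat (t j)) * s' j i)
          = (\<Sum>j<d. int n * s' j i + t j * (if i = j then 1 else 0))"
      proof (rule sum.cong)
        fix j assume "j \<in> {..<d}"
        then have j: "j < d" by simp
        have "int (n - nat (t j)) = int n - t j" "int (nat (t j)) = t j" using t j
          by (auto simp: of_nat_diff nat_le_iff)
        then have "int (nat (t j)) * s j i + int (n - nat (t j)) * s' j i = int n * s' j i + t j * (s j i - s' j i)"
          by (simp add: algebra_simps)
        then show "int (nat (t j)) * s j i + int (n - nat (t j)) * s' j i = int n * s' j i + t j * (if i = j then 1 else 0)"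
          using ss(3)[OF j, of i] by simp
      qed simp
      also have "\<dots> = int n * ?b i + (\<Sum>j<d. if i = j then t j else 0)"
        by (simp add: sum.distrib sum_distrib_left if_distrib[where f = "\<lambda>x. _ * x"] cong: if_cong)
      also have "(\<Sum>j<d. if i = j then t j else 0) = t i"
        using t by (auto simp: zvec_def)
      finally show ?thesis .
    qed
    ultimately show ?thesis by simp
  qed
  moreover have "L (\<lambda>i. int n * ?b i + t i) \<le> real n * ?\<beta>"
    if t: "t \<in> zvec d" "\<forall>i<d. t i \<in> {0..<int n}" for n t
  proof -
    have "L t \<le> (\<Sum>i<d. real n * \<bar>a i\<bar>)"
      unfolding pair_a_def
    proof (rule sum_mono)
      fix i assume "i \<in> {..<d}"
      then have "0 \<le> t i" "t i < int n" using t by auto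
      then have "0 \<le> real_of_int (t i)" "real_of_int (t i) \<le> real n" by linarith+
      then have "real_of_int (t i) * \<bar>a i\<bar> \<le> real n * \<bar>a i\<bar>"
        by (intro mult_right_mono) auto
      moreover have "real_of_int (t i) * a i \<le> real_of_int (t i) * \<bar>a i\<bar>"
        using \<open>0 \<le> real_of_int (t i)\<close> by (intro mult_left_mono) auto
      ultimately show "real_of_int (t i) * a i \<le> real n * \<bar>a i\<bar>" by linarith
    qed
    then have "L t \<le> real n * (\<Sum>i<d. \<bar>a i\<bar>)" by (simp add: sum_distrib_left)
    then show ?thesis
      by (simp only: pair_a_add pair_a_scale distrib_left)
  qed
  ultimately show ?thesis by (intro exI[of _ ?b] exI[of _ ?\<beta>]) simp
qed

section \<open>Value systems of p-families\<close>

text \<open>\<open>T e\<close> models the values of the ideal at \<open>p ^ e\<close>: adding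
  elements of \<open>S\<close> reflects multiplication by ring elements, and multiplying by
  \<open>p\<close> reflects that p-th powers pass to the next level.\<close>

definition p_system :: "nat \<Rightarrow> (nat \<Rightarrow> (nat \<Rightarrow> int) set) \<Rightarrow> bool" where
  "p_system p T \<longleftrightarrow> (\<forall>e. T e \<subseteq> S) \<and> (\<forall>e. \<forall>u\<in>T e. \<forall>v\<in>S. (\<lambda>i. u i + v i) \<in> T e) \<and>
     (\<forall>e. \<forall>u\<in>T e. (\<lambda>i. int p * u i) \<in> T (Suc e))"

lemma p_systemD:
  assumes "p_system p T"
  shows "T e \<subseteq> S"
    and "u \<in> T e \<Longrightarrow> v \<in> S \<Longrightarrow> (\<lambda>i. u i + v i) \<in> T e"
    and "u \<in> T e \<Longrightarrow> (\<lambda>i. int p * u i) \<in> T (Suc e)"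
  using assms by (simp_all add: p_system_def)

lemma p_system_const: "p_system p (\<lambda>_. S)"
  by (simp add: p_system_def S_add S_scale)

lemma p_system_power:
  assumes "p_system p T" "u \<in> T e"
  shows "(\<lambda>i. int (p ^ k) * u i) \<in> T (e + k)"
proof (induction k)
  case (Suc k)
  then have "(\<lambda>i. int p * (int (p ^ k) * u i)) \<in> T (Suc (e + k))"
    by (rule p_systemD(3)[OF assms(1)])
  then show ?case by (simp add: mult.assoc)
qed (use assms in simp)

text \<open>Pairs of \<open>u\<close> in \<open>T e\<close> and \<open>t\<close> in a box of side
  \<open>p ^ k\<close> give distinct points \<open>p ^ k * (u + b) + t\<close> of
  \<open>T (e + k)\<close>. Making room for \<open>b\<close> and \<open>t\<close> costs a slab of
  width \<beta> at level \<open>e\<close>, whence the error term.\<close>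

lemma scaled_box_count:
  assumes T: "p_system p T" and p: "1 < p" and c: "0 < c"
  shows "\<exists>C. \<forall>e k. real (cnt (T (e + k)) (c * real p ^ (e + k))) \<ge>
    (real (cnt (T e) (c * real p ^ e)) - C * real p ^ (e * (d - 1))) * real p ^ (k * d)"
proof -
  obtain b \<beta> where \<beta>: "0 \<le> \<beta>" and box: "\<And>n t. t \<in> zvec d \<Longrightarrow> \<forall>i<d. t i \<in> {0..<int n} \<Longrightarrow>
      (\<lambda>i. int n * b i + t i) \<in> S \<and> L (\<lambda>i. int n * b i + t i) \<le> real n * \<beta>"
    using box_in_S by blast
  obtain K where K: "0 < K"
    "\<And>q s t. 1 \<le> q \<Longrightarrow> t \<le> s \<Longrightarrow> s \<le> c * q \<Longrightarrow> finite {u \<in> S. t \<le> L u \<and> L u < s}"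
    "\<And>q s t. 1 \<le> q \<Longrightarrow> t \<le> s \<Longrightarrow> s \<le> c * q \<Longrightarrow>
      real (card {u \<in> S. t \<le> L u \<and> L u < s}) \<le> K * q ^ (d - 1) * (s - t + 1)"
    using slab_count[OF c] by blast
  have "real (cnt (T (e + k)) (c * real p ^ (e + k))) \<ge>
    (real (cnt (T e) (c * real p ^ e)) - (K * (\<beta> + 1)) * real p ^ (e * (d - 1))) * real p ^ (k * d)" for e k
  proof -
    let ?n = "p ^ k"
    \<comment> \<open>Lowering the threshold by \<beta> keeps the image below the threshold at level
      \<open>e + k\<close>, since \<open>box\<close> bounds the added part by
      \<open>p ^ k * \<beta>\<close>.\<close>
    let ?G = "{u \<in> T e. L u < c * real p ^ e - \<beta>}"
    let ?B = "{u \<in> zvec d. \<forall>i<d. u i \<in> {0..<int ?n}}"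
    let ?f = "\<lambda>(u, t). \<lambda>i. int ?n * (u i + b i) + t i"
    have TS: "T e \<subseteq> S" "T (e + k) \<subseteq> S" using p_systemD(1)[OF T] by auto
    have finB: "finite ?B" and cardB: "card ?B = p ^ (k * d)"
      using card_zvec_box[of "{0..<int ?n}" d] by (simp_all add: nat_power_eq power_mult)
    have "inj_on ?f (?G \<times> ?B)"
    proof (rule inj_onI, clarify)
      fix u t u' t'
      assume u: "u \<in> T e" "u' \<in> T e" and t: "t \<in> zvec d" "\<forall>i<d. t i \<in> {0..<int ?n}"
          "t' \<in> zvec d" "\<forall>i<d. t' i \<in> {0..<int ?n}"
        and eq: "(\<lambda>i. int ?n * (u i + b i) + t i) = (\<lambda>i. int ?n * (u' i + b i) + t' i)"
      have "u i = u' i \<and> t i = t' i" for i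
      proof (cases "i < d")
        case True
        have e: "int ?n * (u i + b i) + t i = int ?n * (u' i + b i) + t' i" by (rule fun_cong[OF eq])
        have r: "0 \<le> t i" "t i < int ?n" "0 \<le> t' i" "t' i < int ?n" using t True by auto
        \<comment> \<open>Division by \<open>p ^ k\<close> recovers \<open>u + b\<close> as the
          quotient and \<open>t\<close> as the remainder.\<close>
        have "(int ?n * (u i + b i) + t i) div int ?n = u i + b i"
          using r(1,2) p by simp
        moreover have "(int ?n * (u' i + b i) + t' i) div int ?n = u' i + b i"
          using r(3,4) p by simp
        ultimately show ?thesis using e by simp
      next
        case False
        moreover have "u \<in> zvec d" "u' \<in> zvec d" using u TS S_sub by auto
        ultimately show ?thesis using t by (simp add: zvec_def)
      qed
      then show "u = u' \<and> t = t'" by auto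
    qed
    moreover have "?f ` (?G \<times> ?B) \<subseteq> {u \<in> T (e + k). L u < c * real p ^ (e + k)}"
    proof clarify
      fix u t assume u: "u \<in> T e" "L u < c * real p ^ e - \<beta>"
        and t: "t \<in> zvec d" "\<forall>i<d. t i \<in> {0..<int ?n}"
      have bt: "(\<lambda>i. int ?n * b i + t i) \<in> S" "L (\<lambda>i. int ?n * b i + t i) \<le> real ?n * \<beta>"
        using box[OF t] by auto
      have eq: "(\<lambda>i. int ?n * (u i + b i) + t i) = (\<lambda>i. int ?n * u i + (int ?n * b i + t i))"
        by (simp add: algebra_simps)
      have "(\<lambda>i. int ?n * u i + (int ?n * b i + t i)) \<in> T (e + k)"
        by (rule p_systemD(2)[OF T p_system_power[OF T u(1)] bt(1)])
      moreover have "L (\<lambda>i. int ?n * (u i + b i) + t i) < c * real p ^ (e + k)"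
      proof -
        have "L (\<lambda>i. int ?n * (u i + b i) + t i) = real ?n * L u + L (\<lambda>i. int ?n * b i + t i)"
          unfolding eq by (simp add: pair_a_add pair_a_scale)
        also have "\<dots> \<le> real ?n * (L u + \<beta>)" using bt(2) by (simp add: distrib_left)
        also have "\<dots> < real ?n * (c * real p ^ e)"
          using u p by (intro mult_strict_left_mono) auto
        finally show ?thesis by (simp add: power_add mult_ac)
      qed
      ultimately show "(\<lambda>i. int ?n * (u i + b i) + t i) \<in> T (e + k) \<and>
          L (\<lambda>i. int ?n * (u i + b i) + t i) < c * real p ^ (e + k)"
        unfolding eq by simp
    qed
    ultimately have "card (?G \<times> ?B) \<le> cnt (T (e + k)) (c * real p ^ (e + k))"
      unfolding cnt_def using finite_below_sub[OF TS(2)] by (meson card_inj_on_le)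
    then have "real (card ?G) * real p ^ (k * d) \<le> real (cnt (T (e + k)) (c * real p ^ (e + k)))"
      using cardB by (simp add: card_cartesian_product flip: of_nat_mult of_nat_power)
    moreover have "real (card ?G) \<ge> real (cnt (T e) (c * real p ^ e)) - K * (\<beta> + 1) * real p ^ (e * (d - 1))"
    proof -
      let ?s = "c * real p ^ e"
      have "real (card {u \<in> S. ?s - \<beta> \<le> L u \<and> L u < ?s}) \<le> K * (real p ^ e) ^ (d - 1) * (?s - (?s - \<beta>) + 1)"
        using \<beta> p by (intro K(3)) auto
      then have "real (card {u \<in> S. ?s - \<beta> \<le> L u \<and> L u < ?s}) \<le> K * (\<beta> + 1) * real p ^ (e * (d - 1))"
        by (simp add: power_mult mult_ac)
      moreover have "real (cnt (T e) ?s) \<le> real (cnt (T e) (?s - \<beta>)) + real (card {u \<in> S. ?s - \<beta> \<le> L u \<and> L u < ?s})"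
        using TS \<beta> by (intro cnt_slab) auto
      ultimately show ?thesis unfolding cnt_def by linarith
    qed
    ultimately show ?thesis
      by (meson mult_right_mono of_nat_0_le_iff order_trans zero_le_power)
  qed
  then show ?thesis by blast
qed

end

text \<open>The numbers \<open>X e - Y e\<close> are bounded by \<open>B\<close>, and each is a
  lower bound for all later terms of \<open>X\<close>; as \<open>Y\<close> tends to 0,
  \<open>X\<close> tends to their supremum.\<close>

lemma almost_increasing_convergent:
  fixes X Y :: "nat \<Rightarrow> real"
  assumes bd: "\<And>n. X n \<le> B" and Y: "Y \<longlonglongrightarrow> 0"
    and inc: "\<And>e k. X e - Y e \<le> X (e + k)"
  shows "convergent X"
proof -
  let ?Z = "\<lambda>e. X e - Y e"
  have bdd: "bdd_above (range ?Z)"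
    using inc bd by (intro bdd_aboveI[of _ B]) (fastforce intro: order_trans)
  let ?l = "Sup (range ?Z)"
  have "X \<longlonglongrightarrow> ?l"
  proof (rule LIMSEQ_I)
    fix r :: real assume r: "0 < r"
    then obtain e where e: "?l - r < ?Z e"
      using less_cSup_iff[OF _ bdd, of "?l - r"] by auto
    obtain N where N: "\<And>n. n \<ge> N \<Longrightarrow> \<bar>Y n\<bar> < r" using LIMSEQ_D[OF Y r] by auto
    show "\<exists>no. \<forall>n\<ge>no. norm (X n - ?l) < r"
    proof (intro exI allI impI)
      fix n assume n: "max e N \<le> n"
      then have "?Z e \<le> X n" using inc[of e "n - e"] by simp
      moreover have "?Z n \<le> ?l" using bdd by (intro cSup_upper) auto
      ultimately show "norm (X n - ?l) < r" using e N[of n] n by auto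
    qed
  qed
  then show ?thesis by (rule convergentI)
qed

section \<open>Limits of normalised point counts\<close>

context weighted_monoid
begin

text \<open>\<open>slab_count\<close> on the slab from 0 to \<open>c * q\<close> bounds the ratios,
  and \<open>scaled_box_count\<close> divided by \<open>p ^ ((e + k) * d)\<close> makes them
  increasing up to an error of order \<open>1 / p ^ e\<close>.\<close>

lemma cnt_ratio_convergent:
  assumes T: "p_system p T" and p: "1 < p" and c: "0 < c"
  shows "convergent (\<lambda>e. real (cnt (T e) (c * real p ^ e)) / real (p ^ e) ^ d)"
proof -
  let ?X = "\<lambda>e. real (cnt (T e) (c * real p ^ e)) / real (p ^ e) ^ d"
  obtain C where C: "\<And>e k. real (cnt (T (e + k)) (c * real p ^ (e + k))) \<ge>
    (real (cnt (T e) (c * real p ^ e)) - C * real p ^ (e * (d - 1))) * real p ^ (k * d)"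
    using scaled_box_count[OF T p c] by blast
  obtain K where K: "0 < K"
    "\<And>q s t. 1 \<le> q \<Longrightarrow> t \<le> s \<Longrightarrow> s \<le> c * q \<Longrightarrow> finite {u \<in> S. t \<le> L u \<and> L u < s}"
    "\<And>q s t. 1 \<le> q \<Longrightarrow> t \<le> s \<Longrightarrow> s \<le> c * q \<Longrightarrow>
      real (card {u \<in> S. t \<le> L u \<and> L u < s}) \<le> K * q ^ (d - 1) * (s - t + 1)"
    using slab_count[OF c] by blast
  obtain n where d: "d = Suc n" using d_pos by (cases d) auto
  show ?thesis
  proof (rule almost_increasing_convergent)
    fix e
    let ?q = "real p ^ e"
    have q: "1 \<le> ?q" using p by simp
    have "T e \<subseteq> S" by (rule p_systemD(1)[OF T])
    then have "{u \<in> T e. L u < c * ?q} \<subseteq> {u \<in> S. 0 \<le> L u \<and> L u < c * ?q}" using L_nonneg by auto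
    moreover have "finite {u \<in> S. 0 \<le> L u \<and> L u < c * ?q}"
      by (rule finite_subset[OF _ finite_below[of "c * ?q"]]) auto
    ultimately have "real (cnt (T e) (c * ?q)) \<le> real (card {u \<in> S. 0 \<le> L u \<and> L u < c * ?q})"
      unfolding cnt_def using card_mono by fastforce
    also have "\<dots> \<le> K * ?q ^ (d - 1) * (c * ?q - 0 + 1)"
      using q c by (intro K(3)) auto
    also have "\<dots> \<le> K * ?q ^ (d - 1) * ((c + 1) * ?q)"
      using q K(1) by (intro mult_left_mono) (auto simp: algebra_simps)
    also have "\<dots> = K * (c + 1) * ?q ^ d" by (simp add: d)
    finally show "?X e \<le> K * (c + 1)" using q p by (simp add: pos_divide_le_eq)
  next
    have "(\<lambda>e. C * (1 / real p) ^ e) \<longlonglongrightarrow> C * 0"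
      using p by (intro tendsto_mult tendsto_const LIMSEQ_realpow_zero) auto
    then show "(\<lambda>e. C * (1 / real p) ^ e) \<longlonglongrightarrow> 0" by simp
  next
    fix e k
    let ?x = "real (cnt (T e) (c * real p ^ e))"
    have p0: "real p > 0" using p by simp
    have "?X e - C * (1 / real p) ^ e = (?x - C * real p ^ (e * (d - 1))) * real p ^ (k * d) / real (p ^ (e + k)) ^ d"
      using p0 by (simp add: d field_simps power_add power_mult power_mult_distrib flip: power_mult)
    also have "\<dots> \<le> ?X (e + k)"
      using C[of e k] by (intro divide_right_mono) auto
    finally show "?X e - C * (1 / real p) ^ e \<le> ?X (e + k)" .
  qed
qed

text \<open>A box of side \<open>n\<close> translated by \<open>n * b\<close> has values at most
  \<open>n * \<beta>\<close>. For \<open>n = p ^ (e - j)\<close> and large \<open>j\<close> this is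
  below \<open>\<delta> * p ^ e\<close>, while the box still has a fixed fraction of
  \<open>(p ^ e) ^ d\<close> points.\<close>

lemma cnt_S_lower:
  assumes p: "1 < p" and \<delta>: "0 < \<delta>"
  shows "\<exists>\<eta>>0. \<exists>j. \<forall>e\<ge>j. \<eta> \<le> real (cnt S (\<delta> * real p ^ e)) / real (p ^ e) ^ d"
proof -
  obtain b \<beta> where \<beta>: "0 \<le> \<beta>" and box: "\<And>n t. t \<in> zvec d \<Longrightarrow> \<forall>i<d. t i \<in> {0..<int n} \<Longrightarrow>
      (\<lambda>i. int n * b i + t i) \<in> S \<and> L (\<lambda>i. int n * b i + t i) \<le> real n * \<beta>"
    using box_in_S by blast
  obtain j where j: "\<beta> / \<delta> < real p ^ j" using p real_arch_pow[of "real p"] by auto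
  have "1 / (real p ^ j) ^ d \<le> real (cnt S (\<delta> * real p ^ e)) / real (p ^ e) ^ d" if "j \<le> e" for e
  proof -
    define n where "n = p ^ (e - j)"
    have n: "real p ^ e = real n * real p ^ j" "0 < n"
      using that p by (auto simp: n_def simp flip: power_add)
    let ?B = "{u \<in> zvec d. \<forall>i<d. u i \<in> {0..<int n}}"
    let ?f = "\<lambda>t i. int n * b i + t i"
    have "inj_on ?f ?B" by (rule inj_onI) (auto simp: fun_eq_iff)
    moreover have "?f ` ?B \<subseteq> {u \<in> S. L u < \<delta> * real p ^ e}"
    proof clarify
      fix t assume t: "t \<in> zvec d" "\<forall>i<d. t i \<in> {0..<int n}"
      have "(\<lambda>i. int n * b i + t i) \<in> S" and "L (\<lambda>i. int n * b i + t i) \<le> real n * \<beta>"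
        using box[OF t] by auto
      note this(2)
      also have "\<dots> < real n * (\<delta> * real p ^ j)"
        using j \<delta> n(2) by (intro mult_strict_left_mono) (auto simp: field_simps)
      also have "\<dots> = \<delta> * real p ^ e" by (simp add: n)
      finally show "(\<lambda>i. int n * b i + t i) \<in> S \<and> L (\<lambda>i. int n * b i + t i) < \<delta> * real p ^ e"
        using \<open>(\<lambda>i. int n * b i + t i) \<in> S\<close> by simp
    qed
    ultimately have "card ?B \<le> cnt S (\<delta> * real p ^ e)"
      unfolding cnt_def using finite_below by (meson card_inj_on_le)
    then have "real n ^ d \<le> real (cnt S (\<delta> * real p ^ e))"
      using card_zvec_box[of "{0..<int n}" d] by (simp flip: of_nat_power)
    moreover have "1 / (real p ^ j) ^ d = real n ^ d / real (p ^ e) ^ d"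
      using p n by (simp add: power_mult_distrib)
    ultimately show ?thesis by (simp add: divide_right_mono)
  qed
  then show ?thesis using p by (intro exI[of _ "1 / (real p ^ j) ^ d"]) auto
qed

text \<open>The multiples \<open>p ^ k * w\<close> of a point given by \<open>small\<close>
  translate \<open>S\<close> into \<open>T (e + j + k)\<close>. What is left out lies in a slab
  whose width relative to \<open>p ^ (e + j + k)\<close> is below
  \<open>\<kappa> / p ^ j\<close>.\<close>

lemma cnt_diff_upper:
  assumes T: "p_system p T" and p: "1 < p" and c: "0 < c"
    and small: "\<And>j. \<exists>e. \<exists>w\<in>T (e + j). L w < \<kappa> * real p ^ e"
    and lim: "(\<lambda>e. (real (cnt S (c * real p ^ e)) - real (cnt (T e) (c * real p ^ e))) / real (p ^ e) ^ d) \<longlonglongrightarrow> l"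
  shows "l \<le> 0"
proof -
  let ?X = "\<lambda>e. (real (cnt S (c * real p ^ e)) - real (cnt (T e) (c * real p ^ e))) / real (p ^ e) ^ d"
  obtain n where d: "d = Suc n" using d_pos by (cases d) auto
  obtain K where K: "0 < K"
    "\<And>q s t. 1 \<le> q \<Longrightarrow> t \<le> s \<Longrightarrow> s \<le> c * q \<Longrightarrow> finite {u \<in> S. t \<le> L u \<and> L u < s}"
    "\<And>q s t. 1 \<le> q \<Longrightarrow> t \<le> s \<Longrightarrow> s \<le> c * q \<Longrightarrow>
      real (card {u \<in> S. t \<le> L u \<and> L u < s}) \<le> K * q ^ (d - 1) * (s - t + 1)"
    using slab_count[OF c] by blast
  have inv0: "(\<lambda>j. (1 / real p) ^ j) \<longlonglongrightarrow> 0" using p by (intro LIMSEQ_realpow_zero) auto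
  have bound: "l \<le> K * \<kappa> * (1 / real p) ^ j" for j
  proof -
    obtain e w where w: "w \<in> T (e + j)" "L w < \<kappa> * real p ^ e" using small by blast
    \<comment> \<open>The first term is the slab width \<open>\<kappa> * p ^ (e + k)\<close> divided
      by \<open>p ^ (e + j + k)\<close>; the second stems from the summand 1 in
      \<open>slab_count\<close>.\<close>
    have up: "?X (e + j + k) \<le> K * \<kappa> * (1 / real p) ^ j + K * (1 / real p) ^ (e + j + k)" for k
    proof -
      let ?E = "e + j + k"
      let ?q = "real p ^ ?E" and ?v = "\<lambda>i. int (p ^ k) * w i"
      let ?h = "\<lambda>u i. u i + ?v i"
      have q: "1 \<le> ?q" using p by simp
      have v: "?v \<in> T ?E" by (rule p_system_power[OF T w(1)])
      have vS: "?v \<in> S" using v p_systemD(1)[OF T] by blast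
      have Lv: "L ?v = real p ^ k * L w" by (simp add: pair_a_scale)
      have "?h ` S \<subseteq> T ?E"
        using p_systemD(2)[OF T v] by (auto simp: add.commute)
      then have "cnt (?h ` S) (c * ?q) \<le> cnt (T ?E) (c * ?q)"
        unfolding cnt_def by (intro card_mono finite_below_sub[OF p_systemD(1)[OF T]]) auto
      then have "real (cnt S (c * ?q)) - real (cnt (T ?E) (c * ?q)) \<le> real (cnt S (c * ?q)) - real (cnt S (c * ?q - L ?v))"
        by (simp only: cnt_shift)
      also have "\<dots> \<le> real (card {u \<in> S. c * ?q - L ?v \<le> L u \<and> L u < c * ?q})"
        using cnt_slab[of S "c * ?q - L ?v" "c * ?q"] L_nonneg[OF vS] by simp
      also have "\<dots> \<le> K * ?q ^ (d - 1) * (c * ?q - (c * ?q - L ?v) + 1)"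
        using q L_nonneg[OF vS] by (intro K(3)) auto
      also have "\<dots> \<le> K * ?q ^ (d - 1) * (\<kappa> * real p ^ (e + k) + 1)"
      proof (rule mult_left_mono)
        have "real p ^ k * L w \<le> real p ^ k * (\<kappa> * real p ^ e)"
          using w(2) by (intro mult_left_mono) auto
        then show "c * ?q - (c * ?q - L ?v) + 1 \<le> \<kappa> * real p ^ (e + k) + 1"
          unfolding Lv by (simp add: power_add mult_ac)
      qed (use K(1) in auto)
      finally have "?X ?E \<le> K * ?q ^ (d - 1) * (\<kappa> * real p ^ (e + k) + 1) / ?q ^ d"
        by (simp add: divide_right_mono)
      also have "\<dots> = K * (\<kappa> * real p ^ (e + k) + 1) / ?q"
        using q by (simp add: d)
      also have "\<dots> = K * \<kappa> * (1 / real p) ^ j + K * (1 / real p) ^ ?E"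
        using p by (simp add: field_simps power_add)
      finally show ?thesis .
    qed
    \<comment> \<open>As \<open>e\<close> and \<open>w\<close> depend on \<open>j\<close>, the limit
      over \<open>k\<close> is taken first, with \<open>j\<close> fixed; \<open>j\<close> grows
      afterwards.\<close>
    have "(\<lambda>k. ?X (e + j + k)) \<longlonglongrightarrow> l"
      using LIMSEQ_ignore_initial_segment[OF lim, of "e + j"] by (simp add: add.commute)
    moreover have "(\<lambda>k. K * \<kappa> * (1 / real p) ^ j + K * (1 / real p) ^ (e + j + k)) \<longlonglongrightarrow> K * \<kappa> * (1 / real p) ^ j + K * 0"
      using LIMSEQ_ignore_initial_segment[OF inv0, of "e + j"]
      by (intro tendsto_intros) (simp add: add.commute)
    ultimately show ?thesis
      using up LIMSEQ_le[of "\<lambda>k. ?X (e + j + k)" l] by auto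
  qed
  have "(\<lambda>j. K * \<kappa> * (1 / real p) ^ j) \<longlonglongrightarrow> K * \<kappa> * 0"
    by (intro tendsto_mult tendsto_const inv0)
  then show "l \<le> 0" using bound LIMSEQ_le_const[of _ 0 l] by auto
qed

end

subsection \<open>Ideals\<close>

lemma is_idealD:
  assumes "is_ideal I"
  shows "0 \<in> I" "x \<in> I \<Longrightarrow> y \<in> I \<Longrightarrow> x + y \<in> I" "x \<in> I \<Longrightarrow> r * x \<in> I"
  using assms by (auto simp: is_ideal_def)

lemma is_ideal_uminus: "is_ideal I \<Longrightarrow> x \<in> I \<Longrightarrow> - x \<in> I"
  using is_idealD(3)[of I x "-1"] by simp

lemma is_ideal_diff: "is_ideal I \<Longrightarrow> x \<in> I \<Longrightarrow> y \<in> I \<Longrightarrow> x - y \<in> I"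
  using is_idealD(2)[of I x "- y"] is_ideal_uminus[of I y] by simp

lemma is_ideal_sum:
  assumes "is_ideal I" "\<And>i. i \<in> A \<Longrightarrow> f i \<in> I"
  shows "(\<Sum>i\<in>A. f i) \<in> I"
  using assms(2) by (induction A rule: infinite_finite_induct) (simp_all add: is_idealD[OF assms(1)])

lemma ideal_gen_superset: "S \<subseteq> ideal_gen S"
proof
  fix x assume "x \<in> S"
  then show "x \<in> ideal_gen S"
    unfolding ideal_gen_def by (intro CollectI exI[of _ "{x}"] exI[of _ "\<lambda>_. 1"]) simp
qed

lemma ideal_gen_least: "is_ideal J \<Longrightarrow> S \<subseteq> J \<Longrightarrow> ideal_gen S \<subseteq> J"
  unfolding ideal_gen_def by (auto intro!: is_ideal_sum is_idealD(3))

lemma is_ideal_ideal_gen: "is_ideal (ideal_gen S)"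
  unfolding is_ideal_def
proof (intro conjI ballI allI)
  show "0 \<in> ideal_gen S"
    unfolding ideal_gen_def by (intro CollectI exI[of _ "{}"]) simp
next
  fix x y assume "x \<in> ideal_gen S" "y \<in> ideal_gen S"
  then obtain F c G e where F: "finite F" "F \<subseteq> S" "x = (\<Sum>s\<in>F. c s * s)"
    and G: "finite G" "G \<subseteq> S" "y = (\<Sum>s\<in>G. e s * s)"
    unfolding ideal_gen_def by auto
  have "x = (\<Sum>s\<in>F \<union> G. (if s \<in> F then c s else 0) * s)"
    unfolding F(3) using F G by (intro sum.mono_neutral_cong_left) auto
  moreover have "y = (\<Sum>s\<in>F \<union> G. (if s \<in> G then e s else 0) * s)"
    unfolding G(3) using F G by (intro sum.mono_neutral_cong_left) auto
  ultimately have "x + y = (\<Sum>s\<in>F \<union> G. ((if s \<in> F then c s else 0) + (if s \<in> G then e s else 0)) * s)"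
    by (simp add: sum.distrib distrib_right)
  then show "x + y \<in> ideal_gen S"
    unfolding ideal_gen_def using F(1,2) G(1,2)
    by (intro CollectI exI[of _ "F \<union> G"]
        exI[of _ "\<lambda>s. (if s \<in> F then c s else 0) + (if s \<in> G then e s else 0)"]) auto
next
  fix r x assume "x \<in> ideal_gen S"
  then obtain F c where F: "finite F" "F \<subseteq> S" "x = (\<Sum>s\<in>F. c s * s)"
    unfolding ideal_gen_def by auto
  then have "r * x = (\<Sum>s\<in>F. (r * c s) * s)" by (simp add: sum_distrib_left mult.assoc)
  then show "r * x \<in> ideal_gen S"
    unfolding ideal_gen_def using F by (intro CollectI exI[of _ F] exI[of _ "\<lambda>s. r * c s"]) auto
qed

text \<open>With one factor of a product fixed, this lets containment in \<open>K\<close> be tested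
  on generators of the other factor.\<close>

lemma is_ideal_colon: "is_ideal K \<Longrightarrow> is_ideal {x. x * y \<in> K}"
  unfolding is_ideal_def by (auto simp: distrib_right mult.assoc)

text \<open>Multiplying a monomial of degree \<open>n\<close> by a generator raises one exponent by
  1; colon ideals reduce the inductive step to this case, one factor at a time.\<close>

lemma ideal_pow_gen_monomials:
  assumes "finite F"
  shows "ideal_pow (ideal_gen F) n \<subseteq> ideal_gen {\<Prod>g\<in>F. g ^ k g | k. sum k F = n}"
proof (induction n)
  case 0
  have "x \<in> ideal_gen {\<Prod>g\<in>F. g ^ k g | k. sum k F = 0}" for x
  proof -
    have "(\<Prod>g\<in>F. g ^ (0::nat)) \<in> {\<Prod>g\<in>F. g ^ k g | k. sum k F = 0}"
      by (intro CollectI exI[of _ "\<lambda>_. 0"]) simp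
    then have "1 \<in> ideal_gen {\<Prod>g\<in>F. g ^ k g | k. sum k F = 0}"
      using ideal_gen_superset by fastforce
    then show ?thesis using is_idealD(3)[OF is_ideal_ideal_gen, of 1 _ x] by simp
  qed
  then show ?case by blast
next
  case (Suc n)
  let ?M = "\<lambda>n. {\<Prod>g\<in>F. g ^ k g | k. sum k F = n}"
  let ?K = "ideal_gen (?M (Suc n))"
  have K: "is_ideal ?K" by (rule is_ideal_ideal_gen)
  have gy: "y * g \<in> ?K" if "g \<in> F" "y \<in> ideal_gen (?M n)" for g y
  proof -
    have "y * g \<in> ?K" if "y \<in> ?M n" for y
    proof -
      from that obtain k where k: "y = (\<Prod>g\<in>F. g ^ k g)" "sum k F = n" by blast
      let ?k = "k(g := Suc (k g))"
      have "y * g = (\<Prod>h\<in>F. h ^ ?k h)"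
        unfolding k(1) using assms \<open>g \<in> F\<close> by (simp add: prod.remove[of F g] mult_ac)
      moreover have "sum ?k F = Suc n"
        using k(2) assms \<open>g \<in> F\<close> by (simp add: sum.remove[of F g])
      ultimately have "y * g \<in> ?M (Suc n)" by blast
      then show ?thesis by (rule subsetD[OF ideal_gen_superset])
    qed
    then have "ideal_gen (?M n) \<subseteq> {y. y * g \<in> ?K}"
      by (intro ideal_gen_least is_ideal_colon K) blast
    then show ?thesis using that(2) by blast
  qed
  have "x * y \<in> ?K" if "x \<in> ideal_gen F" "y \<in> ideal_gen (?M n)" for x y
  proof -
    have "ideal_gen F \<subseteq> {x. x * y \<in> ?K}"
      using gy[OF _ that(2)] by (intro ideal_gen_least is_ideal_colon K) (auto simp: mult.commute)
    then show ?thesis using that(1) by blast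
  qed
  then have "{x * y |x y. x \<in> ideal_gen F \<and> y \<in> ideal_pow (ideal_gen F) n} \<subseteq> ?K"
    using Suc.IH by blast
  then show ?case
    unfolding ideal_pow.simps ideal_prod_def by (rule ideal_gen_least[OF K])
qed

text \<open>Pigeonhole: a monomial of degree exceeding \<open>N |F|\<close> contains an \<open>N\<close>-th power of a generator.\<close>

lemma ideal_pow_gen_subset:
  assumes "finite F" "is_ideal K" "\<And>g. g \<in> F \<Longrightarrow> g ^ N \<in> K"
  shows "ideal_pow (ideal_gen F) (card F * N + 1) \<subseteq> K"
proof -
  have "y \<in> K" if "y \<in> {\<Prod>g\<in>F. g ^ k g | k. sum k F = card F * N + 1}" for y
  proof -
    from that obtain k where k: "y = (\<Prod>g\<in>F. g ^ k g)" "sum k F = card F * N + 1" by blast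
    obtain g where g: "g \<in> F" "N \<le> k g"
    proof (rule ccontr)
      assume "\<not> thesis"
      then have "sum k F \<le> (\<Sum>g\<in>F. N)" using that by (intro sum_mono) (meson nat_le_linear)
      then show False using k(2) by simp
    qed
    have pw: "g ^ k g = g ^ (k g - N) * g ^ N" using g(2) by (simp flip: power_add)
    have "y = ((\<Prod>h\<in>F - {g}. h ^ k h) * g ^ (k g - N)) * g ^ N"
      unfolding k(1) using assms(1) g(1) pw by (simp add: prod.remove[of F g] mult_ac)
    then show ?thesis using is_idealD(3)[OF assms(2) assms(3)[OF g(1)]] by simp
  qed
  then show ?thesis
    using ideal_pow_gen_monomials[OF assms(1)] ideal_gen_least[OF assms(2)] by blast
qed

lemma is_ideal_add_principal:
  assumes "is_ideal K"
  shows "is_ideal {k + r * x | k r. k \<in> K}"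
  unfolding is_ideal_def
proof (intro conjI ballI allI)
  show "0 \<in> {k + r * x | k r. k \<in> K}"
    using is_idealD(1)[OF assms] by (intro CollectI exI[of _ 0]) simp
next
  fix y z assume "y \<in> {k + r * x | k r. k \<in> K}" "z \<in> {k + r * x | k r. k \<in> K}"
  then obtain k r k' r' where *: "k \<in> K" "y = k + r * x" "k' \<in> K" "z = k' + r' * x" by blast
  show "y + z \<in> {k + r * x | k r. k \<in> K}"
    by (rule CollectI, rule exI[of _ "k + k'"], rule exI[of _ "r + r'"])
       (simp add: * algebra_simps is_idealD(2)[OF assms])
next
  fix s y assume "y \<in> {k + r * x | k r. k \<in> K}"
  then obtain k r where *: "k \<in> K" "y = k + r * x" by blast
  show "s * y \<in> {k + r * x | k r. k \<in> K}"
    by (rule CollectI, rule exI[of _ "s * k"], rule exI[of _ "s * r"])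
       (use * is_idealD(3)[OF assms] in \<open>simp add: distrib_left mult.assoc\<close>)
qed

text \<open>By Zorn's lemma a non-unit lies in a maximal ideal, and \<open>m\<close> is the only
  one.\<close>

lemma local_ring_unit:
  assumes "local_ring_with_max m" "x \<notin> m"
  shows "\<exists>y. y * x = 1"
proof (rule ccontr)
  assume nu: "\<nexists>y. y * x = 1"
  \<comment> \<open>Properness is written \<open>1 \<notin> J\<close>, which passes to unions of
    chains.\<close>
  let ?A = "{J. is_ideal J \<and> x \<in> J \<and> 1 \<notin> J}"
  have one: "J = UNIV" if "is_ideal J" "1 \<in> J" for J
    using is_idealD(3)[OF that] by (metis UNIV_eq_I mult_1_right)
  have "is_ideal {0 + r * x | k r. k \<in> {0}}"
    using is_ideal_add_principal[of "{0}" x] by (simp add: is_ideal_def)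
  moreover have "x \<in> {0 + r * x | k r. k \<in> {0}}" by (auto intro: exI[of _ 1])
  moreover have "1 \<notin> {0 + r * x | k r. k \<in> {0}}" using nu by auto
  ultimately have "?A \<noteq> {}" by blast
  moreover have "\<Union>C \<in> ?A" if C: "C \<noteq> {}" "subset.chain ?A C" for C
  proof -
    have CA: "\<And>J. J \<in> C \<Longrightarrow> is_ideal J \<and> x \<in> J \<and> 1 \<notin> J"
      and tot: "\<And>J K. J \<in> C \<Longrightarrow> K \<in> C \<Longrightarrow> J \<subseteq> K \<or> K \<subseteq> J"
      using C(2) unfolding subset_chain_def by blast+
    have "y + z \<in> \<Union>C" if yz: "y \<in> \<Union>C" "z \<in> \<Union>C" for y z
    proof -
      from yz obtain J K where JK: "J \<in> C" "y \<in> J" "K \<in> C" "z \<in> K" by blast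
      from tot[OF JK(1,3)] show ?thesis
      proof
        assume "J \<subseteq> K"
        then have "y + z \<in> K" using JK CA is_idealD(2) by blast
        then show ?thesis using JK by blast
      next
        assume "K \<subseteq> J"
        then have "y + z \<in> J" using JK CA is_idealD(2) by blast
        then show ?thesis using JK by blast
      qed
    qed
    then have "is_ideal (\<Union>C)"
      unfolding is_ideal_def using C(1) CA is_idealD(1,3) by blast
    then show ?thesis using C(1) CA by blast
  qed
  ultimately obtain M where M: "M \<in> ?A" "\<And>X. X \<in> ?A \<Longrightarrow> M \<subseteq> X \<Longrightarrow> X = M"
    using subset_Zorn_nonempty[of ?A] by blast
  have "maximal_ideal M"
    unfolding maximal_ideal_def
  proof (intro conjI allI impI)
    fix J assume "is_ideal J \<and> M \<subseteq> J"
    then show "J = M \<or> J = UNIV" using M one[of J] by blast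
  qed (use M in auto)
  then have "M = m" using assms(1) unfolding local_ring_with_max_def by blast
  then show False using M(1) assms(2) by blast
qed

text \<open>Gaussian elimination over the residue field \<open>R/m\<close>, with denominators cleared.\<close>

lemma nontrivial_relation_mod:
  fixes m :: "'a::idom set"
  assumes "prime_ideal m" and "finite B" "finite X" "card B < card X"
  shows "\<exists>k. (\<exists>x\<in>X. k x \<notin> m) \<and> (\<forall>b\<in>B. (\<Sum>x\<in>X. k x * c x b) \<in> m)"
  using assms(2-4)
proof (induction B arbitrary: X c rule: finite_induct)
  case empty
  have "1 \<notin> m" using assms(1) is_idealD(3)[of m 1] unfolding prime_ideal_def by auto
  moreover have "X \<noteq> {}" using empty by auto
  ultimately show ?case by (intro exI[of _ "\<lambda>_. 1"]) auto
next
  case (insert b0 B)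
  have m: "is_ideal m" and prime: "\<And>x y. x * y \<in> m \<Longrightarrow> x \<in> m \<or> y \<in> m"
    using assms(1) unfolding prime_ideal_def by auto
  show ?case
  proof (cases "\<forall>x\<in>X. c x b0 \<in> m")
    case True
    have "card B < card X" using insert by simp
    then obtain k where k: "\<exists>x\<in>X. k x \<notin> m" "\<forall>b\<in>B. (\<Sum>x\<in>X. k x * c x b) \<in> m"
      using insert.IH[OF insert.prems(1), of c] by blast
    moreover have "(\<Sum>x\<in>X. k x * c x b0) \<in> m"
      using True by (intro is_ideal_sum[OF m] is_idealD(3)[OF m]) blast
    ultimately show ?thesis by (intro exI[of _ k]) blast
  next
    case False
    then obtain x0 where x0: "x0 \<in> X" "c x0 b0 \<notin> m" by blast
    let ?X = "X - {x0}"
    \<comment> \<open>The pivot \<open>c x0 b0\<close> is outside \<open>m\<close>.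
      Cross-multiplying with the row of \<open>x0\<close> clears the column \<open>b0\<close>
      without division.\<close>
    let ?c = "\<lambda>x b. c x0 b0 * c x b - c x b0 * c x0 b"
    have "card B < card ?X" "finite ?X" using insert x0 by auto
    then obtain k where k: "\<exists>x\<in>?X. k x \<notin> m" "\<forall>b\<in>B. (\<Sum>x\<in>?X. k x * ?c x b) \<in> m"
      using insert.IH[of ?X ?c] by blast
    \<comment> \<open>The coefficient at \<open>x0\<close> is the one that makes
      \<open>sum_eq\<close> true. The others are multiplied by the pivot, and since \<open>m\<close>
      is prime, one outside \<open>m\<close> stays outside.\<close>
    let ?k = "\<lambda>x. if x = x0 then - (\<Sum>x\<in>?X. k x * c x b0) else k x * c x0 b0"
    have sum_eq: "(\<Sum>x\<in>X. ?k x * c x b) = (\<Sum>x\<in>?X. k x * ?c x b)" for b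
    proof -
      have "(\<Sum>x\<in>X. ?k x * c x b) = ?k x0 * c x0 b + (\<Sum>x\<in>?X. ?k x * c x b)"
        using insert.prems(1) x0(1) by (rule sum.remove)
      also have "(\<Sum>x\<in>?X. ?k x * c x b) = (\<Sum>x\<in>?X. k x * c x0 b0 * c x b)"
        by (rule sum.cong) auto
      also have "?k x0 * c x0 b = - (\<Sum>x\<in>?X. k x * c x b0 * c x0 b)"
        by (simp add: sum_distrib_right)
      finally show ?thesis by (simp add: sum_subtractf algebra_simps)
    qed
    have "\<exists>x\<in>X. ?k x \<notin> m" using k(1) prime x0(2) by (metis (no_types, lifting) Diff_iff singletonI)
    moreover have "(\<Sum>x\<in>X. ?k x * c x b) \<in> m" if "b \<in> insert b0 B" for b
    proof (cases "b = b0")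
      case True
      then have "(\<Sum>x\<in>X. ?k x * c x b) = 0" unfolding sum_eq by (simp add: mult.commute)
      then show ?thesis using is_idealD(1)[OF m] by simp
    next
      case False
      then show ?thesis using that k(2) unfolding sum_eq by blast
    qed
    ultimately show ?thesis by (intro exI[of _ ?k]) blast
  qed
qed

subsection \<open>OK valuations\<close>

definition emb :: "'a::idom \<Rightarrow> 'a fract" where "emb x = Fract x 1"

lemma emb_simps [simp]:
  "emb 0 = 0" "emb 1 = 1" "emb (x + y) = emb x + emb y" "emb (x * y) = emb x * emb y"
  "emb (- x) = - emb x" "emb (x - y) = emb x - emb y" "emb x = 0 \<longleftrightarrow> x = 0"
  by (simp_all add: emb_def Zero_fract_def One_fract_def eq_fract)

lemma emb_sum: "emb (sum f A) = (\<Sum>i\<in>A. emb (f i))"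
  by (induction A rule: infinite_finite_induct) simp_all

lemma emb_power: "emb (x ^ n) = emb x ^ n"
  by (induction n) simp_all

lemma fract_emb_denom: "\<exists>b g. b \<noteq> 0 \<and> x * emb b = emb g"
proof -
  obtain g b where "x = Fract g b" "b \<noteq> 0" by (cases x) auto
  then have "x * emb b = emb g" by (simp add: emb_def eq_fract)
  then show ?thesis using \<open>b \<noteq> 0\<close> by blast
qed

lemma common_denom: "\<exists>b. b \<noteq> 0 \<and> (\<forall>i<n::nat. \<exists>g. f i * emb b = emb g)"
proof (induction n)
  case 0
  show ?case by (intro exI[of _ 1]) simp
next
  case (Suc n)
  then obtain b where b: "b \<noteq> 0" "\<And>i. i < n \<Longrightarrow> \<exists>g. f i * emb b = emb g" by blast
  obtain b' g' where b': "b' \<noteq> 0" "f n * emb b' = emb g'" using fract_emb_denom by blast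
  have "\<exists>g. f i * emb (b * b') = emb g" if "i < Suc n" for i
  proof (cases "i = n")
    case True
    have "f n * emb (b * b') = (f n * emb b') * emb b" by (simp add: mult_ac)
    also have "\<dots> = emb (g' * b)" unfolding b'(2) by simp
    finally show ?thesis using True by blast
  next
    case False
    then have "i < n" using that by simp
    then obtain g where g: "f i * emb b = emb g" using b(2) by blast
    have "f i * emb (b * b') = (f i * emb b) * emb b'" by (simp add: mult_ac)
    also have "\<dots> = emb (g * b')" unfolding g by simp
    finally show ?thesis by blast
  qed
  then show ?case using b(1) b'(1) by (intro exI[of _ "b * b'"]) simp
qed

locale ok_local_domain =
  fixes m :: "'a::idom set" and d :: nat and a :: "nat \<Rightarrow> real" and \<nu> :: "'a fract \<Rightarrow> nat \<Rightarrow> int"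
  assumes loc: "local_ring_with_max m" and indep_a: "rat_lin_indep d a" and ok: "ok_valuation d a m \<nu>"
begin

text \<open>As \<open>a\<close> is rationally independent, this real number determines the value
  vector, see \<open>pair_a_inj\<close>.\<close>

definition W :: "'a fract \<Rightarrow> real" where "W x = pair_a d a (\<nu> x)"

text \<open>The implication gives 0 infinite value, whatever \<open>\<nu> 0\<close> is.\<close>

definition Fge :: "real \<Rightarrow> 'a fract set" where "Fge t = {x. x \<noteq> 0 \<longrightarrow> t \<le> W x}"

definition Fgt :: "real \<Rightarrow> 'a fract set" where "Fgt t = {x. x \<noteq> 0 \<longrightarrow> t < W x}"

lemma val: "is_valuation d a \<nu>"
  using ok by (simp add: ok_valuation_def)

lemma nu_zvec: "x \<noteq> 0 \<Longrightarrow> \<nu> x \<in> zvec d"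
proof -
  assume "x \<noteq> 0"
  then have "\<nu> x \<in> \<nu> ` {x. x \<noteq> 0}" by blast
  then show ?thesis using val unfolding is_valuation_def by simp
qed

lemma nu_surj: "u \<in> zvec d \<Longrightarrow> \<exists>x. x \<noteq> 0 \<and> \<nu> x = u"
proof -
  assume "u \<in> zvec d"
  then have "u \<in> \<nu> ` {x. x \<noteq> 0}" using val unfolding is_valuation_def by simp
  then show ?thesis by blast
qed

lemma nu_mult: "x \<noteq> 0 \<Longrightarrow> y \<noteq> 0 \<Longrightarrow> \<nu> (x * y) = (\<lambda>i. \<nu> x i + \<nu> y i)"
  using val unfolding is_valuation_def by simp

lemma W_mult: "x \<noteq> 0 \<Longrightarrow> y \<noteq> 0 \<Longrightarrow> W (x * y) = W x + W y"
  by (simp add: W_def nu_mult pair_a_add)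

lemma W_add: "x \<noteq> 0 \<Longrightarrow> y \<noteq> 0 \<Longrightarrow> x + y \<noteq> 0 \<Longrightarrow> min (W x) (W y) \<le> W (x + y)"
  using val unfolding is_valuation_def W_def by (elim conjE) simp

lemma nu_one: "\<nu> 1 = (\<lambda>_. 0)"
  using nu_mult[of 1 1] by (auto simp: fun_eq_iff)

lemma W_one [simp]: "W 1 = 0"
  by (simp add: W_def nu_one)

lemma W_uminus [simp]: "W (- x) = W x"
proof (cases "x = 0")
  case False
  have "W (-1) + W (-1) = W 1" using W_mult[of "-1" "-1"] by simp
  then have "W (-1) = 0" by simp
  then show ?thesis using W_mult[of "-1" x] False by simp
qed simp

lemma W_inverse: "x \<noteq> 0 \<Longrightarrow> W (inverse x) = - W x"
  using W_mult[of x "inverse x"] by simp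

lemma nu_power: "x \<noteq> 0 \<Longrightarrow> \<nu> (x ^ n) = (\<lambda>i. int n * \<nu> x i)"
  by (induction n) (simp_all add: nu_one nu_mult distrib_right)

lemma pair_a_inj:
  assumes "u \<in> zvec d" "u' \<in> zvec d" "pair_a d a u = pair_a d a u'"
  shows "u = u'"
proof
  fix i
  let ?c = "\<lambda>i. rat_of_int (u i - u' i)"
  have "(\<Sum>i<d. of_rat (?c i) * a i) = 0"
    using assms(3) by (simp add: pair_a_def of_rat_diff left_diff_distrib sum_subtractf)
  then have "\<forall>i<d. ?c i = 0"
    by (rule indep_a[unfolded rat_lin_indep_def, THEN spec, THEN mp])
  then show "u i = u' i" using assms(1,2) by (cases "i < d") (auto simp: zvec_def)
qed

lemma zero_F [simp]: "0 \<in> Fge t" "0 \<in> Fgt t"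
  by (simp_all add: Fge_def Fgt_def)

lemma Fge_add: "x \<in> Fge t \<Longrightarrow> y \<in> Fge t \<Longrightarrow> x + y \<in> Fge t"
  using W_add[of x y] by (cases "x = 0 \<or> y = 0 \<or> x + y = 0") (auto simp: Fge_def)

lemma Fgt_add: "x \<in> Fgt t \<Longrightarrow> y \<in> Fgt t \<Longrightarrow> x + y \<in> Fgt t"
  using W_add[of x y] by (cases "x = 0 \<or> y = 0 \<or> x + y = 0") (auto simp: Fgt_def)

lemma F_uminus: "x \<in> Fge t \<Longrightarrow> - x \<in> Fge t" "x \<in> Fgt t \<Longrightarrow> - x \<in> Fgt t"
  by (simp_all add: Fge_def Fgt_def)

lemma Fge_diff: "x \<in> Fge t \<Longrightarrow> y \<in> Fge t \<Longrightarrow> x - y \<in> Fge t"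
  using Fge_add[of x t "- y"] F_uminus(1)[of y] by simp

lemma Fgt_diff: "x \<in> Fgt t \<Longrightarrow> y \<in> Fgt t \<Longrightarrow> x - y \<in> Fgt t"
  using Fgt_add[of x t "- y"] F_uminus(2)[of y] by simp

lemma Fgt_imp_Fge: "x \<in> Fgt t \<Longrightarrow> x \<in> Fge t"
  by (auto simp: Fge_def Fgt_def)

lemma Fge_imp_Fgt: "x \<in> Fge t \<Longrightarrow> s < t \<Longrightarrow> x \<in> Fgt s"
  by (auto simp: Fge_def Fgt_def)

lemma Fge_sum: "(\<And>i. i \<in> A \<Longrightarrow> f i \<in> Fge t) \<Longrightarrow> (\<Sum>i\<in>A. f i) \<in> Fge t"
  by (induction A rule: infinite_finite_induct) (auto intro: Fge_add)

lemma Fgt_sum: "(\<And>i. i \<in> A \<Longrightarrow> f i \<in> Fgt t) \<Longrightarrow> (\<Sum>i\<in>A. f i) \<in> Fgt t"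
  by (induction A rule: infinite_finite_induct) (auto intro: Fgt_add)

lemma Fge_mult: "x \<in> Fge s \<Longrightarrow> y \<in> Fge t \<Longrightarrow> x * y \<in> Fge (s + t)"
  using W_mult[of x y] by (auto simp: Fge_def)

lemma Fgt_mult: "x \<in> Fgt s \<Longrightarrow> y \<in> Fge t \<Longrightarrow> x * y \<in> Fgt (s + t)"
  using W_mult[of x y] by (auto simp: Fge_def Fgt_def)

lemma Fgt_mult': "x \<in> Fge s \<Longrightarrow> y \<in> Fgt t \<Longrightarrow> x * y \<in> Fgt (s + t)"
  using W_mult[of x y] by (auto simp: Fge_def Fgt_def)

lemma emb_Fge: "emb x \<in> Fge 0"
proof -
  have "Fract x 1 \<in> val_ring d a \<nu>" using ok unfolding ok_valuation_def by (elim conjE) simp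
  then show ?thesis by (auto simp: val_ring_def val_ge_def Fge_def emb_def W_def)
qed

lemma W_emb_nonneg: "x \<noteq> 0 \<Longrightarrow> 0 \<le> W (emb x)"
  using emb_Fge[of x] by (simp add: Fge_def)

lemma m_iff: "x \<in> m \<longleftrightarrow> emb x \<in> Fgt 0"
proof -
  have "x \<in> m \<longleftrightarrow> Fract x 1 \<in> val_max d a \<nu>" using ok unfolding ok_valuation_def by (elim conjE) simp
  then show ?thesis by (auto simp: val_max_def Fgt_def emb_def W_def)
qed

lemma emb_mult_Fge: "x \<in> Fge t \<Longrightarrow> emb c * x \<in> Fge t"
  using Fge_mult[OF emb_Fge, of x t c] by simp

lemma emb_mult_Fgt: "x \<in> Fgt t \<Longrightarrow> emb c * x \<in> Fgt t"
  using Fgt_mult'[OF emb_Fge, of x t c] by simp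

lemma m_mult_Fgt: "c \<in> m \<Longrightarrow> x \<in> Fge t \<Longrightarrow> emb c * x \<in> Fgt t"
  using Fgt_mult[of "emb c" 0 x t] by (simp add: m_iff)

lemma is_ideal_m: "is_ideal m"
  using loc unfolding local_ring_with_max_def maximal_ideal_def by blast

lemma one_notin_m: "1 \<notin> m"
  by (simp add: m_iff Fgt_def)

text \<open>Values of ring elements are nonnegative and add up in products, so a product of positive
  value has a factor of positive value.\<close>

lemma prime_ideal_m: "prime_ideal m"
  unfolding prime_ideal_def
proof (intro conjI allI impI is_ideal_m)
  show "m \<noteq> UNIV" using one_notin_m by blast
  fix x y assume "x * y \<in> m"
  then show "x \<in> m \<or> y \<in> m"
    using W_mult[of "emb x" "emb y"] W_emb_nonneg[of x] W_emb_nonneg[of y]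
    by (auto simp: m_iff Fgt_def)
qed

section \<open>Graded pieces of the valuation and the residue degree\<close>

text \<open>For \<open>f i\<close> in \<open>Fge t\<close> this is linear independence over the
  residue field of the classes in the quotient of \<open>Fge t\<close> by \<open>Fgt t\<close>, with
  coefficients lifted to the ring.\<close>

definition indep :: "real \<Rightarrow> ('b \<Rightarrow> 'a fract) \<Rightarrow> 'b set \<Rightarrow> bool" where
  "indep t f A \<longleftrightarrow> (\<forall>c. (\<Sum>i\<in>A. emb (c i) * f i) \<in> Fgt t \<longrightarrow> (\<forall>i\<in>A. c i \<in> m))"

text \<open>By condition (iii) every \<open>f i\<close> is, modulo the maximal ideal of
  \<open>V\<close>, a combination of a finite set \<open>B\<close>; more than \<open>card B\<close>
  such vectors admit a nontrivial relation modulo \<open>m\<close>.\<close>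

lemma indep_bounded:
  "\<exists>N. \<forall>(f :: nat \<Rightarrow> 'a fract) n. (\<forall>i<n. f i \<in> Fge 0) \<longrightarrow> indep 0 f {..<n} \<longrightarrow> n \<le> N"
proof -
  have F0: "val_ring d a \<nu> = Fge 0" "val_max d a \<nu> = Fgt 0"
    by (auto simp: val_ring_def val_max_def val_ge_def Fge_def Fgt_def W_def)
  have "\<exists>B. finite B \<and> B \<subseteq> Fge 0 \<and> (\<forall>y\<in>Fge 0. \<exists>c. y - (\<Sum>b\<in>B. emb (c b) * b) \<in> Fgt 0)"
    using ok unfolding ok_valuation_def F0 emb_def by (elim conjE)
  then obtain B where B: "finite B" "B \<subseteq> Fge 0"
    "\<forall>y\<in>Fge 0. \<exists>c. y - (\<Sum>b\<in>B. emb (c b) * b) \<in> Fgt 0"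
    by (elim exE conjE)
  have "n \<le> card B" if f: "\<forall>i<n. f i \<in> Fge 0" "indep 0 f {..<n}" for f :: "nat \<Rightarrow> 'a fract" and n
  proof (rule ccontr)
    assume "\<not> n \<le> card B"
    then have "card B < card {..<n}" by simp
    have "\<forall>i. \<exists>c. i < n \<longrightarrow> f i - (\<Sum>b\<in>B. emb (c b) * b) \<in> Fgt 0" using B(3) f(1) by simp
    from choice[OF this] obtain c where c: "\<forall>i. i < n \<longrightarrow> f i - (\<Sum>b\<in>B. emb (c i b) * b) \<in> Fgt 0" ..
    obtain k where k: "\<exists>i\<in>{..<n}. k i \<notin> m" "\<forall>b\<in>B. (\<Sum>i<n. k i * c i b) \<in> m"
      using nontrivial_relation_mod[OF prime_ideal_m B(1) finite_lessThan \<open>card B < card {..<n}\<close>, of c] by blast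
    \<comment> \<open>Both parts have positive value: the first by the choice of the expansions, the
      second because the coefficient of each element of \<open>B\<close> lies in
      \<open>m\<close>.\<close>
    have "(\<Sum>i<n. emb (k i) * f i) = (\<Sum>i<n. emb (k i) * (f i - (\<Sum>b\<in>B. emb (c i b) * b)))
        + (\<Sum>i<n. emb (k i) * (\<Sum>b\<in>B. emb (c i b) * b))"
      by (simp add: right_diff_distrib sum_subtractf)
    also have "(\<Sum>i<n. emb (k i) * (\<Sum>b\<in>B. emb (c i b) * b)) = (\<Sum>b\<in>B. emb (\<Sum>i<n. k i * c i b) * b)"
      unfolding emb_sum sum_distrib_left sum_distrib_right
      by (subst sum.swap) (simp add: mult.assoc)
    also have "(\<Sum>i<n. emb (k i) * (f i - (\<Sum>b\<in>B. emb (c i b) * b))) + \<dots> \<in> Fgt 0"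
    proof (rule Fgt_add)
      show "(\<Sum>i<n. emb (k i) * (f i - (\<Sum>b\<in>B. emb (c i b) * b))) \<in> Fgt 0"
        using c by (intro Fgt_sum emb_mult_Fgt) simp
      show "(\<Sum>b\<in>B. emb (\<Sum>i<n. k i * c i b) * b) \<in> Fgt 0"
        by (intro Fgt_sum m_mult_Fgt) (use k(2) B(2) in auto)
    qed
    finally have "\<forall>i\<in>{..<n}. k i \<in> m" by (rule f(2)[unfolded indep_def, THEN spec, THEN mp])
    then show False using k(1) by blast
  qed
  then show ?thesis by blast
qed

text \<open>The residue degree \<open>[\<kappa>\<^sub>V : \<kappa>]\<close>.\<close>

definition res_deg :: nat where
  "res_deg = Max {n. \<exists>f :: nat \<Rightarrow> 'a fract. (\<forall>i<n. f i \<in> Fge 0) \<and> indep 0 f {..<n}}"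

lemma res_deg_set:
  "finite {n. \<exists>f :: nat \<Rightarrow> 'a fract. (\<forall>i<n. f i \<in> Fge 0) \<and> indep 0 f {..<n}}"
proof -
  obtain N where "\<forall>(f :: nat \<Rightarrow> 'a fract) n. (\<forall>i<n. f i \<in> Fge 0) \<longrightarrow> indep 0 f {..<n} \<longrightarrow> n \<le> N"
    using indep_bounded by blast
  then have "{n. \<exists>f :: nat \<Rightarrow> 'a fract. (\<forall>i<n. f i \<in> Fge 0) \<and> indep 0 f {..<n}} \<subseteq> {..N}" by blast
  then show ?thesis by (rule finite_subset) simp
qed

lemma res_deg_ge: "(\<And>i. i < n \<Longrightarrow> f i \<in> Fge 0) \<Longrightarrow> indep 0 f {..<n::nat} \<Longrightarrow> n \<le> res_deg"
  unfolding res_deg_def by (intro Max_ge res_deg_set) blast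

lemma res_deg_pos: "0 < res_deg"
proof -
  have "1 \<le> res_deg"
    by (rule res_deg_ge[of 1 "\<lambda>_. 1"]) (auto simp: Fge_def indep_def m_iff lessThan_Suc)
  then show ?thesis by simp
qed

lemma res_deg_attained: "\<exists>f :: nat \<Rightarrow> 'a fract. (\<forall>i<res_deg. f i \<in> Fge 0) \<and> indep 0 f {..<res_deg}"
proof -
  have "0 \<in> {n. \<exists>f :: nat \<Rightarrow> 'a fract. (\<forall>i<n. f i \<in> Fge 0) \<and> indep 0 f {..<n}}"
    by (simp add: indep_def)
  then have "res_deg \<in> {n. \<exists>f :: nat \<Rightarrow> 'a fract. (\<forall>i<n. f i \<in> Fge 0) \<and> indep 0 f {..<n}}"
    unfolding res_deg_def by (intro Max_in res_deg_set) blast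
  then show ?thesis by blast
qed

text \<open>Multiplication by \<open>z\<close> carries the graded piece at \<open>t\<close>
  isomorphically onto the one at \<open>t + W z\<close>.\<close>

lemma indep_scale:
  assumes "z \<noteq> 0" "indep t f A"
  shows "indep (t + W z) (\<lambda>i. f i * z) A"
  unfolding indep_def
proof (intro allI impI)
  fix c assume "(\<Sum>i\<in>A. emb (c i) * (f i * z)) \<in> Fgt (t + W z)"
  then have "(\<Sum>i\<in>A. emb (c i) * (f i * z)) * inverse z \<in> Fgt (t + W z + W (inverse z))"
    by (rule Fgt_mult) (simp add: Fge_def)
  moreover have "(\<Sum>i\<in>A. emb (c i) * (f i * z)) * inverse z = (\<Sum>i\<in>A. emb (c i) * f i)"
    using assms(1) by (simp add: sum_distrib_right mult.assoc)
  ultimately have "(\<Sum>i\<in>A. emb (c i) * f i) \<in> Fgt t" using assms(1) by (simp add: W_inverse)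
  then show "\<forall>i\<in>A. c i \<in> m" by (rule assms(2)[unfolded indep_def, THEN spec, THEN mp])
qed

text \<open>Division by \<open>z\<close> moves the family to level 0, and a bijection renumbers it,
  because \<open>res_deg\<close> is a maximum over families indexed by initial segments.\<close>

lemma indep_card_le:
  assumes A: "finite A" and z: "z \<noteq> 0" and f: "\<And>i. i \<in> A \<Longrightarrow> f i \<in> Fge (W z)" and ind: "indep (W z) f A"
  shows "card A \<le> res_deg"
proof -
  obtain h where h: "bij_betw h {0..<card A} A" using ex_bij_betw_nat_finite[OF A] by blast
  let ?g = "\<lambda>i. f (h i) * inverse z"
  have "?g i \<in> Fge 0" if "i < card A" for i
  proof -
    have "f (h i) \<in> Fge (W z)" using h that by (intro f) (auto dest: bij_betwE)
    then have "?g i \<in> Fge (W z + W (inverse z))"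
      by (rule Fge_mult) (simp add: Fge_def)
    then show ?thesis using z by (simp add: W_inverse)
  qed
  moreover have "indep 0 ?g {..<card A}"
  proof -
    have "indep (W z + W (inverse z)) (\<lambda>i. f i * inverse z) A"
      using z by (intro indep_scale ind) simp
    then have I: "indep 0 (\<lambda>i. f i * inverse z) A" using z by (simp add: W_inverse)
    show ?thesis unfolding indep_def
    proof (intro allI impI ballI)
      fix c i assume c: "(\<Sum>i\<in>{..<card A}. emb (c i) * ?g i) \<in> Fgt 0" and i: "i \<in> {..<card A}"
      let ?h = "the_inv_into {0..<card A} h"
      have inj: "inj_on h {0..<card A}" using h by (rule bij_betw_imp_inj_on)
      have "(\<Sum>j\<in>A. emb (c (?h j)) * (f j * inverse z)) = (\<Sum>i\<in>{0..<card A}. emb (c (?h (h i))) * ?g i)"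
        by (rule sum.reindex_bij_betw[OF h, symmetric])
      also have "\<dots> = (\<Sum>i\<in>{..<card A}. emb (c i) * ?g i)"
        by (rule sum.cong) (auto simp: the_inv_into_f_f[OF inj])
      finally have "(\<Sum>j\<in>A. emb (c (?h j)) * (f j * inverse z)) \<in> Fgt 0" using c by simp
      then have "\<forall>j\<in>A. c (?h j) \<in> m"
        by (rule I[unfolded indep_def, THEN spec, THEN mp])
      moreover have "h i \<in> A" using i h by (auto dest: bij_betwE)
      ultimately have "c (?h (h i)) \<in> m" by blast
      then show "c i \<in> m" using i by (simp add: the_inv_into_f_f[OF inj])
    qed
  qed
  ultimately show ?thesis by (rule res_deg_ge)
qed

text \<open>A residue basis lifted to \<open>V\<close> is multiplied by a common denominator
  \<open>b\<close>, which gives \<open>g i\<close> in the ring. For every nonzero \<open>y\<close>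
  the ideal of \<open>y\<close> then contains \<open>res_deg\<close> independent elements at the
  value of \<open>b * y\<close>. The translation by the value of \<open>b\<close> reappears in
  \<open>colength_bounds\<close>.\<close>

lemma basis_shift:
  "\<exists>b g. b \<noteq> 0 \<and> (\<forall>y. y \<noteq> 0 \<longrightarrow> (\<forall>i<res_deg. emb (g i * y) \<in> Fge (W (emb (b * y)))) \<and>
     indep (W (emb (b * y))) (\<lambda>i. emb (g i * y)) {..<res_deg})"
proof -
  obtain f :: "nat \<Rightarrow> 'a fract" where f: "\<forall>i<res_deg. f i \<in> Fge 0" "indep 0 f {..<res_deg}"
    using res_deg_attained by blast
  obtain b where b: "b \<noteq> 0" "\<forall>i<res_deg. \<exists>g. f i * emb b = emb g" using common_denom by blast
  then obtain g where g: "\<And>i. i < res_deg \<Longrightarrow> f i * emb b = emb (g i)" by metis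
  have "(\<forall>i<res_deg. emb (g i * y) \<in> Fge (W (emb (b * y)))) \<and>
     indep (W (emb (b * y))) (\<lambda>i. emb (g i * y)) {..<res_deg}" if y: "y \<noteq> 0" for y
  proof
    have eq: "emb (g i * y) = f i * emb (b * y)" if "i < res_deg" for i
      by (simp add: mult.assoc flip: g[OF that])
    show "\<forall>i<res_deg. emb (g i * y) \<in> Fge (W (emb (b * y)))"
    proof (intro allI impI)
      fix i assume i: "i < res_deg"
      have "f i * emb (b * y) \<in> Fge (0 + W (emb (b * y)))"
        using f(1) i by (intro Fge_mult) (auto simp: Fge_def)
      then show "emb (g i * y) \<in> Fge (W (emb (b * y)))" unfolding eq[OF i] by simp
    qed
    have "indep (0 + W (emb (b * y))) (\<lambda>i. f i * emb (b * y)) {..<res_deg}"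
      using b(1) y f(2) by (intro indep_scale) auto
    moreover have "(\<Sum>i<res_deg. emb (c i) * emb (g i * y)) = (\<Sum>i<res_deg. emb (c i) * (f i * emb (b * y)))" for c
      using eq by (intro sum.cong) auto
    ultimately show "indep (W (emb (b * y))) (\<lambda>i. emb (g i * y)) {..<res_deg}"
      unfolding indep_def by simp
  qed
  then show ?thesis using b(1) by (intro exI[of _ b] exI[of _ g]) blast
qed

text \<open>Take the last index whose coefficient is outside \<open>m\<close>, hence a unit. Later
  terms have value above \<open>t\<close>, and dividing by the unit contradicts
  \<open>tri\<close>.\<close>

lemma indep_triangular:
  fixes f :: "nat \<Rightarrow> 'a fract"
  assumes A: "finite A" and f: "\<And>i. i \<in> A \<Longrightarrow> f i \<in> Fge t"
    and tri: "\<And>i c. i \<in> A \<Longrightarrow> f i + (\<Sum>j\<in>{j\<in>A. j < i}. emb (c j) * f j) \<notin> Fgt t"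
  shows "indep t f A"
  unfolding indep_def
proof (intro allI impI, rule ccontr)
  fix c assume c: "(\<Sum>i\<in>A. emb (c i) * f i) \<in> Fgt t" and "\<not> (\<forall>i\<in>A. c i \<in> m)"
  let ?N = "{i\<in>A. c i \<notin> m}"
  have N: "?N \<noteq> {}" "finite ?N" using \<open>\<not> (\<forall>i\<in>A. c i \<in> m)\<close> A by auto
  define i where "i = Max ?N"
  have i: "i \<in> A" "c i \<notin> m" using Max_in[OF N(2,1)] unfolding i_def by auto
  have above: "c j \<in> m" if "j \<in> A" "i < j" for j
  proof (rule ccontr)
    assume "c j \<notin> m"
    then have "j \<le> i" unfolding i_def using that(1) by (intro Max_ge N(2)) simp
    then show False using that(2) by simp
  qed
  obtain y where y: "y * c i = 1" using local_ring_unit[OF loc i(2)] by blast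
  have split: "A = insert i ({j\<in>A. j < i} \<union> {j\<in>A. i < j})" using i by auto
  have "(\<Sum>j\<in>A. emb (c j) * f j) = emb (c i) * f i + ((\<Sum>j\<in>{j\<in>A. j < i}. emb (c j) * f j) + (\<Sum>j\<in>{j\<in>A. i < j}. emb (c j) * f j))"
  proof -
    have "(\<Sum>j\<in>insert i ({j\<in>A. j < i} \<union> {j\<in>A. i < j}). emb (c j) * f j)
        = emb (c i) * f i + (\<Sum>j\<in>{j\<in>A. j < i} \<union> {j\<in>A. i < j}. emb (c j) * f j)"
      using A by (intro sum.insert) auto
    also have "(\<Sum>j\<in>{j\<in>A. j < i} \<union> {j\<in>A. i < j}. emb (c j) * f j)
        = (\<Sum>j\<in>{j\<in>A. j < i}. emb (c j) * f j) + (\<Sum>j\<in>{j\<in>A. i < j}. emb (c j) * f j)"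
      using A by (intro sum.union_disjoint) auto
    finally show ?thesis unfolding split[symmetric] .
  qed
  moreover have "(\<Sum>j\<in>{j\<in>A. i < j}. emb (c j) * f j) \<in> Fgt t"
    using above f by (intro Fgt_sum m_mult_Fgt) auto
  ultimately have "emb (c i) * f i + (\<Sum>j\<in>{j\<in>A. j < i}. emb (c j) * f j) \<in> Fgt t"
    using Fgt_diff[OF c, of "\<Sum>j\<in>{j\<in>A. i < j}. emb (c j) * f j"] by (simp add: algebra_simps)
  then have "emb y * (emb (c i) * f i + (\<Sum>j\<in>{j\<in>A. j < i}. emb (c j) * f j)) \<in> Fgt t"
    by (rule emb_mult_Fgt)
  moreover have "emb y * (emb (c i) * f i + (\<Sum>j\<in>{j\<in>A. j < i}. emb (c j) * f j))
      = emb (y * c i) * f i + (\<Sum>j\<in>{j\<in>A. j < i}. emb (y * c j) * f j)"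
    by (simp add: distrib_left sum_distrib_left mult.assoc)
  ultimately show False using tri[OF i(1), of "\<lambda>j. y * c j"] unfolding y by simp
qed

end

text \<open>Bolzano-Weierstrass, one coordinate at a time: each step passes to a subsequence that is
  monotone in the next coordinate.\<close>

lemma coordinatewise_convergent_subseq:
  fixes X :: "nat \<Rightarrow> nat \<Rightarrow> real"
  assumes "\<And>n i. \<bar>X n i\<bar> \<le> B"
  shows "\<exists>r :: nat \<Rightarrow> nat. strict_mono r \<and> (\<forall>i<k. convergent (\<lambda>n. X (r n) i))"
proof (induction k)
  case 0
  show ?case by (intro exI[of _ id]) (simp add: strict_mono_def)
next
  case (Suc k)
  then obtain r :: "nat \<Rightarrow> nat" where r: "strict_mono r" "\<forall>i<k. convergent (\<lambda>n. X (r n) i)" by blast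
  obtain f :: "nat \<Rightarrow> nat" where "strict_mono f \<and> monoseq (\<lambda>n. X (r (f n)) k)"
    using seq_monosub[of "\<lambda>n. X (r n) k"] ..
  then have f: "strict_mono f" "monoseq (\<lambda>n. X (r (f n)) k)" by simp_all
  have "Bseq (\<lambda>n. X (r (f n)) k)" using assms by (intro BseqI'[of _ B]) simp
  then have "convergent (\<lambda>n. X (r (f n)) k)" using f(2) by (rule Bseq_monoseq_convergent)
  moreover have "convergent (\<lambda>n. X (r (f n)) i)" if "i < k" for i
    using convergent_subseq_convergent[OF r(2)[rule_format, OF that] f(1)] by (simp add: comp_def)
  ultimately show ?case
    using r(1) f(1) by (intro exI[of _ "r \<circ> f"]) (auto simp: less_Suc_eq strict_mono_def)
qed

section \<open>The value semigroup of the ring\<close>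

context ok_local_domain
begin

definition Val :: "'a set \<Rightarrow> (nat \<Rightarrow> int) set" where
  "Val J = {\<nu> (emb x) | x. x \<in> J \<and> x \<noteq> 0}"

lemma Val_zvec: "u \<in> Val J \<Longrightarrow> u \<in> zvec d"
  unfolding Val_def using nu_zvec by auto

lemma Val_mono: "J \<subseteq> K \<Longrightarrow> Val J \<subseteq> Val K"
  unfolding Val_def by blast

lemma Val_nonneg: "u \<in> Val J \<Longrightarrow> 0 \<le> pair_a d a u"
  unfolding Val_def using W_emb_nonneg by (auto simp: W_def)

lemma Val_add:
  assumes "is_ideal J" "u \<in> Val J" "v \<in> Val UNIV"
  shows "(\<lambda>i. u i + v i) \<in> Val J"
proof -
  obtain x y where x: "x \<in> J" "x \<noteq> 0" "u = \<nu> (emb x)" and y: "y \<noteq> 0" "v = \<nu> (emb y)"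
    using assms(2,3) unfolding Val_def by blast
  have "(\<lambda>i. u i + v i) = \<nu> (emb (y * x))"
    using nu_mult[of "emb y" "emb x"] x y by (simp add: add.commute)
  moreover have "y * x \<in> J" "y * x \<noteq> 0" using x y is_idealD(3)[OF assms(1)] by auto
  ultimately show ?thesis unfolding Val_def by blast
qed

text \<open>Compactness makes condition (ii) uniform: without such an \<epsilon>, a subsequence of
  normalised counterexamples would converge to a nonzero vector of the closed cone whose pairing
  with \<open>a\<close> is at most 0.\<close>

lemma cone_bound: "\<exists>\<epsilon>>0. \<forall>u\<in>Val UNIV. \<forall>i<d. \<epsilon> * \<bar>real_of_int (u i)\<bar> \<le> pair_a d a u"
proof (rule ccontr)
  assume contr: "\<not> ?thesis"
  have "\<exists>u. u \<in> Val UNIV \<and> (\<exists>i<d. pair_a d a u < 1 / real (Suc n) * \<bar>real_of_int (u i)\<bar>)" for n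
  proof (rule ccontr)
    assume "\<not> ?thesis"
    then have "\<forall>u\<in>Val UNIV. \<forall>i<d. 1 / real (Suc n) * \<bar>real_of_int (u i)\<bar> \<le> pair_a d a u"
      by (meson not_le)
    then show False using contr by (meson of_nat_0_less_iff zero_less_Suc zero_less_divide_1_iff)
  qed
  then have "\<forall>n. \<exists>u. u \<in> Val UNIV \<and> (\<exists>i<d. pair_a d a u < 1 / real (Suc n) * \<bar>real_of_int (u i)\<bar>)" by blast
  from choice[OF this] obtain u where u: "\<And>n. u n \<in> Val UNIV"
    "\<And>n. \<exists>i<d. pair_a d a (u n) < 1 / real (Suc n) * \<bar>real_of_int (u n i)\<bar>" by blast
  \<comment> \<open>Dividing by the sum norm bounds all coordinates by 1, and the norm 1 passes to
    the limit, which is therefore nonzero.\<close>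
  define N where "N n = (\<Sum>i<d. \<bar>real_of_int (u n i)\<bar>)" for n
  define X where "X n i = real_of_int (u n i) / N n" for n i
  have coord: "\<bar>real_of_int (u n i)\<bar> \<le> N n" if "i < d" for n i
    unfolding N_def using that by (intro member_le_sum) auto
  have N: "0 < N n" and small: "pair_a d a (u n) < 1 / real (Suc n) * N n" for n
  proof -
    obtain i where i: "i < d" "pair_a d a (u n) < 1 / real (Suc n) * \<bar>real_of_int (u n i)\<bar>" using u(2) by blast
    have "1 / real (Suc n) * \<bar>real_of_int (u n i)\<bar> \<le> 1 / real (Suc n) * N n"
      using coord[OF i(1)] by (intro mult_left_mono) auto
    then show *: "pair_a d a (u n) < 1 / real (Suc n) * N n" using i(2) by linarith
    \<comment> \<open>Together with the strict bound \<open>*\<close> this excludes the zero vector,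
      so division by \<open>N n\<close> is legitimate.\<close>
    have "0 \<le> pair_a d a (u n)" using Val_nonneg[OF u(1)] .
    then have "0 < 1 / real (Suc n) * N n" using * by linarith
    then show "0 < N n" by (simp add: zero_less_divide_iff)
  qed
  have out: "X n i = 0" if "d \<le> i" for n i
    using Val_zvec[OF u(1)] that by (simp add: X_def zvec_def)
  have "\<bar>X n i\<bar> \<le> 1" for n i
    using coord[of i n] N[of n] out[of i n] by (cases "i < d") (auto simp: X_def)
  then obtain r :: "nat \<Rightarrow> nat" where r: "strict_mono r" "\<forall>i<d. convergent (\<lambda>n. X (r n) i)"
    using coordinatewise_convergent_subseq[of X 1 d] by blast
  define l where "l i = lim (\<lambda>n. X (r n) i)" for i
  have l: "(\<lambda>n. X (r n) i) \<longlonglongrightarrow> l i" for i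
  proof (cases "i < d")
    case True
    then show ?thesis using r(2) unfolding l_def convergent_LIMSEQ_iff by blast
  next
    case False
    then show ?thesis using out unfolding l_def by (simp add: lim_def LIMSEQ_const_iff)
  qed
  have sum1: "(\<Sum>i<d. \<bar>X n i\<bar>) = 1" for n
    using N[of n] by (simp add: X_def N_def flip: sum_divide_distrib)
  have "(\<lambda>n. \<Sum>i<d. \<bar>X (r n) i\<bar>) \<longlonglongrightarrow> (\<Sum>i<d. \<bar>l i\<bar>)"
    by (intro tendsto_sum tendsto_rabs l)
  then have "(\<Sum>i<d. \<bar>l i\<bar>) = 1" using sum1 by (simp add: LIMSEQ_const_iff)
  then have "l \<noteq> (\<lambda>_. 0)" by auto
  moreover have "l \<in> closed_cone_gen (\<nu> ` {Fract x 1 | x. x \<noteq> 0})"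
    unfolding closed_cone_gen_def
  proof (intro CollectI exI[of _ "\<lambda>n. X (r n)"] conjI allI l)
    fix n
    have "u (r n) \<in> \<nu> ` {Fract x 1 | x. x \<noteq> 0}"
      using u(1)[of "r n"] unfolding Val_def emb_def by blast
    then show "X (r n) \<in> cone_gen (\<nu> ` {Fract x 1 | x. x \<noteq> 0})"
      unfolding cone_gen_def using N[of "r n"]
      by (intro CollectI exI[of _ "{u (r n)}"] exI[of _ "\<lambda>_. 1 / N (r n)"]) (auto simp: X_def)
  qed
  moreover have "\<forall>u\<in>closed_cone_gen (\<nu> ` {Fract x 1 | x. x \<noteq> 0}). u \<noteq> (\<lambda>_. 0) \<longrightarrow> pair_real d a u > 0"
    using ok unfolding ok_valuation_def by (elim conjE)
  ultimately have pos: "0 < pair_real d a l" by blast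
  have "(\<lambda>n. pair_real d a (X (r n))) \<longlonglongrightarrow> pair_real d a l"
    unfolding pair_real_def by (intro tendsto_intros l)
  moreover have "(\<lambda>n. 1 / real (Suc (r n))) \<longlonglongrightarrow> 0"
    using LIMSEQ_subseq_LIMSEQ[OF LIMSEQ_inverse_real_of_nat r(1)] by (simp add: comp_def inverse_eq_divide)
  moreover have "pair_real d a (X n) \<le> 1 / real (Suc n)" for n
  proof -
    have "pair_real d a (X n) = pair_a d a (u n) / N n"
      by (simp add: pair_real_def pair_a_def X_def sum_divide_distrib)
    then show ?thesis using small[of n] N[of n] by (simp add: pos_divide_le_eq less_imp_le)
  qed
  ultimately have "pair_real d a l \<le> 0" using LIMSEQ_le by blast
  then show False using pos by simp
qed

lemma ideal_pow_one: "ideal_pow m (Suc 0) \<subseteq> m"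
  unfolding ideal_pow.simps ideal_prod_def
  by (rule ideal_gen_least[OF is_ideal_m])
     (use is_idealD(3)[OF is_ideal_m] in \<open>auto simp: mult.commute\<close>)

lemma ok_iv:
  "\<exists>v\<in>zvec d. \<forall>n x. x \<noteq> 0 \<longrightarrow> real n * pair_a d a v \<le> W (emb x) \<longrightarrow> x \<in> ideal_pow m n"
proof -
  have "\<exists>v\<in>zvec d. \<forall>n x. Fract x 1 \<in> val_ge d a \<nu> (\<lambda>i. int n * v i) \<longrightarrow> x \<in> ideal_pow m n"
    using ok unfolding ok_valuation_def by (elim conjE)
  then obtain v where v: "v \<in> zvec d"
    "\<And>n x. Fract x 1 \<in> val_ge d a \<nu> (\<lambda>i. int n * v i) \<Longrightarrow> x \<in> ideal_pow m n" by blast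
  have "x \<in> ideal_pow m n" if "x \<noteq> 0" "real n * pair_a d a v \<le> W (emb x)" for n x
  proof -
    have "emb x \<in> val_ge d a \<nu> (\<lambda>i. int n * v i)"
      using that by (simp add: val_ge_def pair_a_scale W_def)
    then show ?thesis using v(2) by (simp add: emb_def)
  qed
  then show ?thesis using v(1) by blast
qed

lemma deep_in_ideal_pow:
  "\<exists>\<kappa>>0. \<forall>n x. x \<noteq> 0 \<longrightarrow> real n * \<kappa> \<le> W (emb x) \<longrightarrow> x \<in> ideal_pow m n"
proof -
  obtain v where v: "\<And>n x. x \<noteq> 0 \<Longrightarrow> real n * pair_a d a v \<le> W (emb x) \<Longrightarrow> x \<in> ideal_pow m n"
    using ok_iv by blast
  have "x \<in> ideal_pow m n" if "x \<noteq> 0" "real n * max 1 (pair_a d a v) \<le> W (emb x)" for n x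
  proof (rule v[OF that(1)])
    have "real n * pair_a d a v \<le> real n * max 1 (pair_a d a v)" by (intro mult_left_mono) auto
    then show "real n * pair_a d a v \<le> W (emb x)" using that(2) by linarith
  qed
  then show ?thesis by (intro exI[of _ "max 1 (pair_a d a v)"]) auto
qed

text \<open>For \<open>d = 0\<close> every value pairs to 0, and condition (iv) with
  \<open>n = 1\<close> would put 1 into \<open>m\<close>.\<close>

lemma dim_pos: "0 < d"
proof (rule ccontr)
  assume "\<not> 0 < d"
  then have "pair_a d a v = 0" for v by (simp add: pair_a_def)
  then have "\<forall>n x. x \<noteq> 0 \<longrightarrow> 0 \<le> W (emb x) \<longrightarrow> x \<in> ideal_pow m n" using ok_iv by simp
  from this[THEN spec[of _ "Suc 0"], THEN spec[of _ 1]] have "(1::'a) \<in> ideal_pow m (Suc 0)" by (simp del: ideal_pow.simps)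
  then show False using ideal_pow_one one_notin_m by blast
qed

lemma weighted: "\<exists>\<epsilon>. weighted_monoid d a (Val UNIV) \<epsilon>"
proof -
  obtain \<epsilon> where \<epsilon>: "0 < \<epsilon>" "\<And>u i. u \<in> Val UNIV \<Longrightarrow> i < d \<Longrightarrow> \<epsilon> * \<bar>real_of_int (u i)\<bar> \<le> pair_a d a u"
    using cone_bound by blast
  have "weighted_monoid d a (Val UNIV) \<epsilon>"
  proof
    show "0 < d" by (rule dim_pos)
    show "a (d - 1) \<noteq> 0"
    proof
      assume a0: "a (d - 1) = 0"
      \<comment> \<open>A vanishing coordinate of \<open>a\<close> is a rational relation whose
        coefficients form a unit vector.\<close>
      have "(\<Sum>i<d. of_rat (if i = d - 1 then 1 else 0) * a i) = 0"
        by (rule sum.neutral) (use a0 in auto)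
      from indep_a[unfolded rat_lin_indep_def, THEN spec, THEN mp, OF this]
      show False using dim_pos by (auto dest: spec[of _ "d - 1"])
    qed
    show "Val UNIV \<subseteq> zvec d" using Val_zvec by blast
    have "\<nu> (emb 1) \<in> Val UNIV" unfolding Val_def by (intro CollectI exI[of _ 1]) simp
    then show "(\<lambda>_. 0) \<in> Val UNIV" by (simp add: nu_one)
    show "(\<lambda>i. u i + v i) \<in> Val UNIV" if "u \<in> Val UNIV" "v \<in> Val UNIV" for u v
      using that by (intro Val_add) (auto simp: is_ideal_def)
    show "\<exists>s\<in>Val UNIV. \<exists>s'\<in>Val UNIV. \<forall>j. s j - s' j = (if j = i then 1 else 0)" if "i < d" for i
    proof -
      \<comment> \<open>As \<open>\<nu>\<close> is surjective, some fraction has the unit vector as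
        its value; numerator and denominator give the required difference.\<close>
      have "(\<lambda>j. if j = i then 1 else 0) \<in> zvec d" using that by (simp add: zvec_def)
      then obtain x where x: "x \<noteq> 0" "\<nu> x = (\<lambda>j. if j = i then 1 else 0)" using nu_surj by blast
      obtain b g where bg: "b \<noteq> 0" "x * emb b = emb g" using fract_emb_denom by blast
      have "g \<noteq> 0" using bg x by (metis emb_simps(7) mult_eq_0_iff)
      have "\<nu> (emb g) = (\<lambda>j. \<nu> x j + \<nu> (emb b) j)" using nu_mult[of x "emb b"] x bg by simp
      then have "\<forall>j. \<nu> (emb g) j - \<nu> (emb b) j = (if j = i then 1 else 0)" by (simp add: x(2))
      moreover have "\<nu> (emb g) \<in> Val UNIV" "\<nu> (emb b) \<in> Val UNIV"
        unfolding Val_def using \<open>g \<noteq> 0\<close> bg(1) by blast+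
      ultimately show ?thesis by blast
    qed
    show "0 < \<epsilon>" by (rule \<epsilon>(1))
    show "\<epsilon> * \<bar>real_of_int (u i)\<bar> \<le> pair_a d a u" if "u \<in> Val UNIV" "i < d" for u i
      by (rule \<epsilon>(2)[OF that])
  qed
  then show ?thesis ..
qed

end

subsection \<open>Colengths\<close>

text \<open>Unlike in \<open>ideal_chain_from\<close>, the upper end is free, so that chains can be
  built step by step.\<close>

definition ideal_chain :: "'a::comm_ring_1 set \<Rightarrow> 'a set \<Rightarrow> nat \<Rightarrow> bool" where
  "ideal_chain J K n \<longleftrightarrow> (\<exists>C. C 0 = J \<and> C n = K \<and> (\<forall>i\<le>n. is_ideal (C i)) \<and> (\<forall>i<n. C i \<subset> C (Suc i)))"

lemma ideal_chain_refl: "is_ideal J \<Longrightarrow> ideal_chain J J 0"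
  unfolding ideal_chain_def by (intro exI[of _ "\<lambda>_. J"]) simp

lemma ideal_chain_snoc:
  assumes "ideal_chain J K n" "is_ideal K'" "K \<subset> K'"
  shows "ideal_chain J K' (Suc n)"
proof -
  obtain C where C: "C 0 = J" "C n = K" "\<forall>i\<le>n. is_ideal (C i)" "\<forall>i<n. C i \<subset> C (Suc i)"
    using assms(1) unfolding ideal_chain_def by blast
  let ?C = "C(Suc n := K')"
  have "?C 0 = J" "?C (Suc n) = K'" using C by auto
  moreover have "\<forall>i\<le>Suc n. is_ideal (?C i)" using C(3) assms(2) by (auto simp: le_Suc_eq)
  moreover have "\<forall>i<Suc n. ?C i \<subset> ?C (Suc i)" using C(2,4) assms(3) by (auto simp: less_Suc_eq)
  ultimately show ?thesis unfolding ideal_chain_def by (intro exI[of _ ?C] conjI)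
qed

lemma ideal_chain_is_ideal: "ideal_chain J K n \<Longrightarrow> is_ideal K"
  unfolding ideal_chain_def by auto

lemma ideal_chain_from_extend:
  assumes "ideal_chain J K n"
  shows "\<exists>n'\<ge>n. ideal_chain_from J n'"
proof (cases "K = UNIV")
  case True
  then show ?thesis using assms unfolding ideal_chain_def ideal_chain_from_def by blast
next
  case False
  then have "ideal_chain J UNIV (Suc n)"
    using assms by (intro ideal_chain_snoc[of J K]) (auto simp: is_ideal_def)
  then have "ideal_chain_from J (Suc n)" unfolding ideal_chain_def ideal_chain_from_def by blast
  then show ?thesis by (intro exI[of _ "Suc n"]) simp
qed

context ok_local_domain
begin

text \<open>A unit coefficient at \<open>x\<close> could be scaled to 1, against \<open>ext\<close>.
  So it lies in \<open>m\<close>, its term has value above \<open>t\<close>, and the independence of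
  \<open>f\<close> applies to the rest.\<close>

lemma indep_extend:
  assumes f: "indep t f {..<n::nat}" and x: "x \<in> Fge t"
    and ext: "\<And>c. x + (\<Sum>i<n. emb (c i) * f i) \<notin> Fgt t"
  shows "indep t (f(n := x)) {..<Suc n}"
  unfolding indep_def
proof (intro allI impI)
  fix c assume "(\<Sum>i<Suc n. emb (c i) * (f(n := x)) i) \<in> Fgt t"
  moreover have "(\<Sum>i<Suc n. emb (c i) * (f(n := x)) i) = (\<Sum>i<n. emb (c i) * f i) + emb (c n) * x"
    by simp
  ultimately have s: "(\<Sum>i<n. emb (c i) * f i) + emb (c n) * x \<in> Fgt t" by simp
  have cn: "c n \<in> m"
  proof (rule ccontr)
    assume "c n \<notin> m"
    then obtain y where y: "y * c n = 1" using local_ring_unit[OF loc] by blast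
    have "emb y * ((\<Sum>i<n. emb (c i) * f i) + emb (c n) * x) \<in> Fgt t" by (rule emb_mult_Fgt[OF s])
    also have "emb y * ((\<Sum>i<n. emb (c i) * f i) + emb (c n) * x) = emb (y * c n) * x + (\<Sum>i<n. emb (y * c i) * f i)"
      by (simp add: distrib_left sum_distrib_left mult.assoc add.commute)
    finally show False using ext[of "\<lambda>i. y * c i"] unfolding y by simp
  qed
  then have "(\<Sum>i<n. emb (c i) * f i) \<in> Fgt t"
    using Fgt_diff[OF s m_mult_Fgt[OF cn x]] by simp
  then have "\<forall>i\<in>{..<n}. c i \<in> m" by (rule f[unfolded indep_def, THEN spec, THEN mp])
  then show "\<forall>i\<in>{..<Suc n}. c i \<in> m" using cn by (auto simp: less_Suc_eq)
qed

text \<open>In each step of the chain pick an element of maximal value. Elements of equal value \<open>u\<close> are then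
  independent modulo higher values, also together with the elements of \<open>J\<close> of value \<open>u\<close>.\<close>

lemma ideal_chain_length_le:
  assumes fin: "finite {u \<in> Val UNIV. pair_a d a u < \<tau>}" and J: "is_ideal J"
    and big: "\<And>x. x \<noteq> 0 \<Longrightarrow> \<tau> \<le> W (emb x) \<Longrightarrow> x \<in> J"
    and b: "b \<noteq> 0"
    and g: "\<And>y i. y \<noteq> 0 \<Longrightarrow> i < res_deg \<Longrightarrow> emb (g i * y) \<in> Fge (W (emb (b * y)))"
      "\<And>y. y \<noteq> 0 \<Longrightarrow> indep (W (emb (b * y))) (\<lambda>i. emb (g i * y)) {..<res_deg}"
    and chain: "ideal_chain_from J n"
  shows "n \<le> res_deg * card {u \<in> Val UNIV. pair_a d a u < \<tau> \<and> u \<notin> (\<lambda>u i. u i + \<nu> (emb b) i) ` Val J}"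
proof -
  let ?U = "{u \<in> Val UNIV. pair_a d a u < \<tau> \<and> u \<notin> (\<lambda>u i. u i + \<nu> (emb b) i) ` Val J}"
  obtain C where C: "C 0 = J" "C n = UNIV" "\<And>i. i \<le> n \<Longrightarrow> is_ideal (C i)" "\<And>i. i < n \<Longrightarrow> C i \<subset> C (Suc i)"
    using chain unfolding ideal_chain_from_def by blast
  have mono: "C i \<subseteq> C j" if "i \<le> j" "j \<le> n" for i j
    using that
  proof (induction j rule: dec_induct)
    case (step k)
    then show ?case using C(4)[of k] by auto
  qed simp
  have JC: "J \<subseteq> C i" if "i \<le> n" for i using mono[of 0 i] that C(1) by simp
  \<comment> \<open>By \<open>big\<close>, elements outside a member of the chain have value below
    \<tau>. These values are finite in number, so each step has an element of maximal value.\<close>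
  have D: "y \<noteq> 0" "W (emb y) < \<tau>" "\<nu> (emb y) \<in> Val UNIV" if "i < n" "y \<notin> C i" for i y
  proof -
    show y: "y \<noteq> 0" using that C(3)[of i] is_idealD(1) by force
    show "W (emb y) < \<tau>"
    proof (rule ccontr)
      assume "\<not> W (emb y) < \<tau>"
      then have "y \<in> J" using big[OF y] by simp
      then show False using JC[of i] that by auto
    qed
    show "\<nu> (emb y) \<in> Val UNIV" unfolding Val_def using y by blast
  qed
  have "\<exists>x. i < n \<longrightarrow> x \<in> C (Suc i) - C i \<and> (\<forall>y\<in>C (Suc i) - C i. W (emb y) \<le> W (emb x))" for i
  proof (cases "i < n")
    case True
    let ?D = "C (Suc i) - C i"
    let ?V = "(\<lambda>y. W (emb y)) ` ?D"
    have "?V \<subseteq> pair_a d a ` {u \<in> Val UNIV. pair_a d a u < \<tau>}"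
    proof
      fix z assume "z \<in> ?V"
      then obtain y where y: "y \<in> ?D" "z = W (emb y)" by blast
      then have "\<nu> (emb y) \<in> {u \<in> Val UNIV. pair_a d a u < \<tau>}"
        using D[OF True, of y] by (simp add: W_def)
      moreover have "z = pair_a d a (\<nu> (emb y))" by (simp add: y W_def)
      ultimately show "z \<in> pair_a d a ` {u \<in> Val UNIV. pair_a d a u < \<tau>}" by blast
    qed
    then have finV: "finite ?V" using fin by (meson finite_imageI finite_subset)
    have "?V \<noteq> {}" using C(4)[OF True] by auto
    then have "Max ?V \<in> ?V" using finV by (intro Max_in)
    then obtain x where x: "x \<in> ?D" "Max ?V = W (emb x)" by blast
    have "\<forall>y\<in>?D. W (emb y) \<le> W (emb x)"
    proof
      fix y assume "y \<in> ?D"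
      then have "W (emb y) \<le> Max ?V" using finV by (intro Max_ge) auto
      then show "W (emb y) \<le> W (emb x)" using x(2) by simp
    qed
    then show ?thesis using x(1) by blast
  qed simp
  then have "\<forall>i. \<exists>x. i < n \<longrightarrow> x \<in> C (Suc i) - C i \<and> (\<forall>y\<in>C (Suc i) - C i. W (emb y) \<le> W (emb x))" by blast
  from choice[OF this] obtain x where x: "\<And>i. i < n \<Longrightarrow> x i \<in> C (Suc i) - C i"
    "\<And>i y. i < n \<Longrightarrow> y \<in> C (Suc i) - C i \<Longrightarrow> W (emb y) \<le> W (emb (x i))" by blast
  \<comment> \<open>Adding an element of \<open>C i\<close> does not leave
    \<open>C (Suc i) - C i\<close>, so the value cannot exceed the maximum attained at
    \<open>x i\<close>.\<close>
  have key: "emb (x i) + emb s \<notin> Fgt (W (emb (x i)))" if "i < n" "s \<in> C i" for i s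
  proof -
    have Ci: "is_ideal (C i)" "is_ideal (C (Suc i))" using C(3) that by auto
    have "x i + s \<in> C (Suc i)" using is_idealD(2)[OF Ci(2)] x(1)[OF that(1)] that mono[of i "Suc i"] by auto
    moreover have "x i + s \<notin> C i" using is_ideal_diff[OF Ci(1), of "x i + s" s] that x(1)[OF that(1)] by auto
    ultimately have "W (emb (x i + s)) \<le> W (emb (x i))" "x i + s \<noteq> 0"
      using x(2)[OF that(1)] D(1)[OF that(1)] by blast+
    then have "emb (x i + s) \<notin> Fgt (W (emb (x i)))" by (simp add: Fgt_def del: emb_simps(3))
    then show ?thesis by simp
  qed
  define u where "u i = \<nu> (emb (x i))" for i
  have x0: "emb (x i) \<noteq> 0" if "i < n" for i using D(1)[OF that] x(1)[OF that] by auto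
  have Wu: "W (emb (x i)) = pair_a d a (u i)" for i by (simp add: u_def W_def)
  have uU: "u i \<in> ?U" if i: "i < n" for i
  proof -
    \<comment> \<open>If \<open>u i\<close> came from \<open>y\<close> in \<open>J\<close>, the
      elements \<open>g j * y\<close> of \<open>J\<close> would already fill this graded piece, and
      \<open>x i\<close> would be one independent element too many.\<close>
    have "u i \<notin> (\<lambda>u i. u i + \<nu> (emb b) i) ` Val J"
    proof
      assume "u i \<in> (\<lambda>u i. u i + \<nu> (emb b) i) ` Val J"
      then obtain y where y: "y \<in> J" "y \<noteq> 0" "u i = (\<lambda>j. \<nu> (emb y) j + \<nu> (emb b) j)"
        unfolding Val_def by blast
      have "W (emb (b * y)) = W (emb b) + W (emb y)" using W_mult[of "emb b" "emb y"] b y(2) by simp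
      then have t: "W (emb (b * y)) = W (emb (x i))" unfolding Wu y(3) by (simp add: W_def pair_a_add)
      let ?f = "\<lambda>j. emb (g j * y)"
      have "indep (W (emb (x i))) (?f(res_deg := emb (x i))) {..<Suc res_deg}"
      proof (rule indep_extend)
        show "indep (W (emb (x i))) ?f {..<res_deg}" using g(2)[OF y(2)] t by simp
        show "emb (x i) \<in> Fge (W (emb (x i)))" by (simp add: Fge_def)
        fix c
        have "(\<Sum>j<res_deg. c j * (g j * y)) \<in> C i"
          using y(1) JC[of i] i C(3)[of i] by (intro is_ideal_sum is_idealD(3)) auto
        from key[OF i this] show "emb (x i) + (\<Sum>j<res_deg. emb (c j) * ?f j) \<notin> Fgt (W (emb (x i)))"
          by (simp add: emb_sum)
      qed
      moreover have "(?f(res_deg := emb (x i))) j \<in> Fge (W (emb (x i)))" if "j \<in> {..<Suc res_deg}" for j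
        using g(1)[OF y(2), of j] t that by (auto simp: Fge_def less_Suc_eq)
      ultimately have "card {..<Suc res_deg} \<le> res_deg"
        by (intro indep_card_le[OF _ x0[OF i]]) auto
      then show False by simp
    qed
    then show ?thesis using D(2,3)[OF i, of "x i"] x(1)[OF i] by (simp add: u_def W_def)
  qed
  have fib: "card {i\<in>{..<n}. u i = w} \<le> res_deg" for w
  proof (cases "{i\<in>{..<n}. u i = w} = {}")
    case False
    let ?A = "{i\<in>{..<n}. u i = w}"
    from False obtain i0 where i0: "i0 < n" "u i0 = w" by blast
    have W: "W (emb (x i)) = W (emb (x i0))" if "i \<in> ?A" for i using that i0 by (simp add: Wu)
    show ?thesis
    proof (rule indep_card_le[OF _ x0[OF i0(1)]])
      show "emb (x i) \<in> Fge (W (emb (x i0)))" if "i \<in> ?A" for i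
        using W[OF that] by (simp add: Fge_def)
      show "indep (W (emb (x i0))) (\<lambda>i. emb (x i)) ?A"
      proof (rule indep_triangular)
        show "emb (x i) \<in> Fge (W (emb (x i0)))" if "i \<in> ?A" for i
          using W[OF that] by (simp add: Fge_def)
        fix i c assume i: "i \<in> ?A"
        \<comment> \<open>Earlier picks lie in \<open>C i\<close>, so \<open>key\<close> gives the
          triangular condition.\<close>
        have "(\<Sum>j\<in>{j\<in>?A. j < i}. c j * x j) \<in> C i"
        proof (rule is_ideal_sum)
          show "is_ideal (C i)" using C(3) i by simp
          fix j assume "j \<in> {j\<in>?A. j < i}"
          then have "x j \<in> C i" using x(1)[of j] mono[of "Suc j" i] i by auto
          then show "c j * x j \<in> C i" using is_idealD(3) \<open>is_ideal (C i)\<close> by blast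
        qed
        from key[OF _ this] show "emb (x i) + (\<Sum>j\<in>{j\<in>?A. j < i}. emb (c j) * emb (x j)) \<notin> Fgt (W (emb (x i0)))"
          using i W[OF i] by (simp add: emb_sum)
      qed simp
    qed simp
  qed (simp only: card.empty)
  have finU: "finite ?U" by (rule finite_subset[OF _ fin]) auto
  have "n = card {..<n}" by simp
  also have "\<dots> = card (\<Union>w\<in>?U. {i\<in>{..<n}. u i = w})"
    by (rule arg_cong[where f = card]) (use uU in auto)
  also have "\<dots> \<le> (\<Sum>w\<in>?U. card {i\<in>{..<n}. u i = w})" by (rule card_UN_le[OF finU])
  also have "\<dots> \<le> (\<Sum>w\<in>?U. res_deg)" by (rule sum_mono[OF fib])
  finally show ?thesis by (simp add: mult.commute)
qed

text \<open>Adjoining the \<open>x i\<close> one at a time gives \<open>s\<close> strict steps at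
  the value \<open>u\<close>. Elements of \<open>K\<close> agree with elements of \<open>J\<close>
  up to values above \<open>u\<close>; if \<open>x s\<close> were already present, an independent
  combination of value \<open>u\<close> would force \<open>u\<close> into
  \<open>Val J\<close>.\<close>

lemma ideal_chain_level:
  assumes chain: "ideal_chain J K n" and u: "u \<in> zvec d" "u \<notin> Val J" and J: "is_ideal J"
    and K: "\<And>k. k \<in> K \<Longrightarrow> \<exists>j\<in>J. emb (k - j) \<in> Fgt (pair_a d a u)"
    and x: "\<And>i. i < r \<Longrightarrow> emb (x i) \<in> Fge (pair_a d a u)" "indep (pair_a d a u) (\<lambda>i. emb (x i)) {..<r::nat}"
    and s: "s \<le> r"
  shows "\<exists>K'. ideal_chain J K' (n + s) \<and> (\<forall>k'\<in>K'. \<exists>k\<in>K. \<exists>c. k' = k + (\<Sum>i<s. c i * x i))"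
  using s
proof (induction s)
  case 0
  then show ?case using chain by (intro exI[of _ K]) auto
next
  case (Suc s)
  let ?t = "pair_a d a u"
  obtain K' where K': "ideal_chain J K' (n + s)" "\<And>k'. k' \<in> K' \<Longrightarrow> \<exists>k\<in>K. \<exists>c. k' = k + (\<Sum>i<s. c i * x i)"
    using Suc by auto
  let ?K = "{k + r * x s | k r. k \<in> K'}"
  have idK': "is_ideal K'" using K'(1) by (rule ideal_chain_is_ideal)
  have "x s \<notin> K'"
  proof
    assume "x s \<in> K'"
    then obtain k c where k: "k \<in> K" "x s = k + (\<Sum>i<s. c i * x i)" using K'(2) by blast
    obtain j where j: "j \<in> J" "emb (k - j) \<in> Fgt ?t" using K[OF k(1)] by blast
    let ?y = "x s - (\<Sum>i<s. c i * x i)"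
    have y: "?y = k" using k(2) by simp
    \<comment> \<open>These are the coefficients of \<open>x s\<close> minus its earlier terms,
      extended by 0 to all \<open>r\<close> elements; the 1 at \<open>s\<close> is not in
      \<open>m\<close>.\<close>
    let ?c = "\<lambda>i. if i = s then 1 else if i < s then - c i else 0"
    have "(\<Sum>i<r. emb (?c i) * emb (x i)) = (\<Sum>i<Suc s. emb (?c i) * emb (x i))"
      using Suc.prems by (intro sum.mono_neutral_right) auto
    also have "\<dots> = (\<Sum>i<s. emb (- c i) * emb (x i)) + emb (x s)"
      by simp
    also have "\<dots> = emb k" unfolding y[symmetric] by (simp add: emb_sum sum_negf)
    finally have sk: "(\<Sum>i<r. emb (?c i) * emb (x i)) = emb k" .
    have "emb k \<notin> Fgt ?t"
    proof
      assume "emb k \<in> Fgt ?t"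
      then have "\<forall>i\<in>{..<r}. ?c i \<in> m"
        using x(2)[unfolded indep_def, THEN spec[of _ ?c]] sk by simp
      then have "?c s \<in> m" by (rule bspec) (use Suc.prems in simp)
      then show False using one_notin_m by simp
    qed
    moreover have "emb k \<in> Fge ?t"
      unfolding sk[symmetric] using x(1) by (intro Fge_sum emb_mult_Fge) simp
    \<comment> \<open>\<open>k\<close> has value exactly \<open>u\<close> and \<open>k - j\<close> a
      larger one, so \<open>j\<close> has value \<open>u\<close>.\<close>
    ultimately have "emb j \<notin> Fgt ?t" "emb j \<in> Fge ?t"
      using Fgt_add[OF j(2), of "emb j"] Fge_diff[OF _ Fgt_imp_Fge[OF j(2)], of "emb k"] by auto
    then have "j \<noteq> 0" "W (emb j) = ?t" by (auto simp: Fge_def Fgt_def)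
    then have "\<nu> (emb j) = u" using u(1) nu_zvec[of "emb j"] by (intro pair_a_inj) (auto simp: W_def)
    then have "u \<in> Val J" unfolding Val_def using j(1) \<open>j \<noteq> 0\<close> by blast
    then show False using u(2) by simp
  qed
  moreover have "x s \<in> ?K" using is_idealD(1)[OF idK'] by (intro CollectI exI[of _ 0] exI[of _ 1]) simp
  moreover have "K' \<subseteq> ?K"
  proof
    fix k assume "k \<in> K'"
    then show "k \<in> ?K" by (intro CollectI exI[of _ k] exI[of _ 0]) simp
  qed
  ultimately have "K' \<subset> ?K" by blast
  then have "ideal_chain J ?K (Suc (n + s))"
    using K'(1) is_ideal_add_principal[OF idK'] by (intro ideal_chain_snoc)
  moreover have "\<exists>k\<in>K. \<exists>c. k' = k + (\<Sum>i<Suc s. c i * x i)" if "k' \<in> ?K" for k'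
  proof -
    obtain k1 r1 where k1: "k1 \<in> K'" "k' = k1 + r1 * x s" using \<open>k' \<in> ?K\<close> by blast
    obtain k c where k: "k \<in> K" "k1 = k + (\<Sum>i<s. c i * x i)" using K'(2)[OF k1(1)] by blast
    have "k' = k + (\<Sum>i<Suc s. (c(s := r1)) i * x i)" unfolding k1(2) k(2) by simp
    then show ?thesis using k(1) by blast
  qed
  ultimately show ?case by (intro exI[of _ ?K]) simp
qed

text \<open>The missing values are treated from the largest down. Each of them is the value of some
  \<open>b * y\<close>, where the elements \<open>g i * y\<close> supply \<open>res_deg\<close>
  strict steps.\<close>

lemma ideal_chain_length_ge:
  assumes fin: "finite {u \<in> Val UNIV. pair_a d a u < \<tau>}" and J: "is_ideal J"
    and b: "b \<noteq> 0"
    and g: "\<And>y i. y \<noteq> 0 \<Longrightarrow> i < res_deg \<Longrightarrow> emb (g i * y) \<in> Fge (W (emb (b * y)))"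
      "\<And>y. y \<noteq> 0 \<Longrightarrow> indep (W (emb (b * y))) (\<lambda>i. emb (g i * y)) {..<res_deg}"
  shows "\<exists>n\<ge>res_deg * card {u \<in> (\<lambda>u i. u i + \<nu> (emb b) i) ` Val UNIV. pair_a d a u < \<tau> \<and> u \<notin> Val J}.
    ideal_chain_from J n"
proof -
  let ?U = "{u \<in> (\<lambda>u i. u i + \<nu> (emb b) i) ` Val UNIV. pair_a d a u < \<tau> \<and> u \<notin> Val J}"
  have bV: "\<nu> (emb b) \<in> Val UNIV" unfolding Val_def using b by blast
  have sub: "?U \<subseteq> {u \<in> Val UNIV. pair_a d a u < \<tau>}"
    using Val_add[OF _ _ bV, of UNIV] by (auto simp: is_ideal_def)
  then have finU: "finite ?U" using fin by (rule finite_subset)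
  \<comment> \<open>The second conjunct is the invariant: for any \<open>t\<close> below all treated
    values, elements of \<open>K\<close> agree with elements of \<open>J\<close> up to values above
    \<open>t\<close>.\<close>
  have "\<exists>K. ideal_chain J K (res_deg * card U) \<and>
      (\<forall>t. (\<forall>u\<in>U. t < pair_a d a u) \<longrightarrow> (\<forall>k\<in>K. \<exists>j\<in>J. emb (k - j) \<in> Fgt t))" if "U \<subseteq> ?U" for U
    using finite_subset[OF that finU] that
  \<comment> \<open>Ranking by the negated functional inserts the values in descending
    order.\<close>
  proof (induction U rule: finite_ranking_induct[where f = "\<lambda>u. - pair_a d a u"])
    case empty
    have "\<exists>j\<in>J. emb (k - j) \<in> Fgt t" if "k \<in> J" for k t
      using that by (intro bexI[of _ k]) simp_all
    then show ?case using ideal_chain_refl[OF J] by (intro exI[of _ J]) simp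
  next
    case (insert u U)
    obtain K where K: "ideal_chain J K (res_deg * card U)"
      "\<And>t k. \<forall>u\<in>U. t < pair_a d a u \<Longrightarrow> k \<in> K \<Longrightarrow> \<exists>j\<in>J. emb (k - j) \<in> Fgt t"
      using insert by auto
    show ?case
    proof (cases "u \<in> U")
      case True
      then show ?thesis using K by (intro exI[of _ K]) (simp add: insert_absorb)
    next
      case False
      let ?t = "pair_a d a u"
      have uz: "u \<in> zvec d" "u \<notin> Val J" using insert.prems sub Val_zvec by auto
      obtain y where y: "y \<noteq> 0" "u = (\<lambda>i. \<nu> (emb y) i + \<nu> (emb b) i)"
        using insert.prems unfolding Val_def by blast
      have "W (emb (b * y)) = W (emb b) + W (emb y)" using W_mult[of "emb b" "emb y"] b y(1) by simp
      then have t: "W (emb (b * y)) = ?t" unfolding y(2) by (simp add: W_def pair_a_add)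
      have lt: "\<forall>w\<in>U. ?t < pair_a d a w"
      proof
        fix w assume w: "w \<in> U"
        then have "?t \<le> pair_a d a w" using insert.hyps(2)[OF w] by simp
        moreover have "w \<in> zvec d" using w insert.prems sub Val_zvec by blast
        then have "?t \<noteq> pair_a d a w" using pair_a_inj[OF uz(1)] w False by blast
        ultimately show "?t < pair_a d a w" by simp
      qed
      have "\<exists>K'. ideal_chain J K' (res_deg * card U + res_deg) \<and>
          (\<forall>k'\<in>K'. \<exists>k\<in>K. \<exists>c. k' = k + (\<Sum>i<res_deg. c i * (g i * y)))"
        by (rule ideal_chain_level[OF K(1) uz J K(2)[OF lt]]) (use g[OF y(1)] t in auto)
      then obtain K' where K': "ideal_chain J K' (res_deg * card U + res_deg)"
        "\<And>k'. k' \<in> K' \<Longrightarrow> \<exists>k\<in>K. \<exists>c. k' = k + (\<Sum>i<res_deg. c i * (g i * y))" by blast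
      have "\<exists>j\<in>J. emb (k' - j) \<in> Fgt t" if t': "\<forall>u\<in>insert u U. t < pair_a d a u" "k' \<in> K'" for t k'
      proof -
        obtain k c where k: "k \<in> K" "k' = k + (\<Sum>i<res_deg. c i * (g i * y))" using K'(2)[OF t'(2)] by blast
        obtain j where j: "j \<in> J" "emb (k - j) \<in> Fgt ?t" using K(2)[OF lt k(1)] by blast
        have "(\<Sum>i<res_deg. emb (c i) * emb (g i * y)) \<in> Fge ?t"
          using g(1)[OF y(1)] t by (intro Fge_sum emb_mult_Fge) simp
        then have "emb (k - j) + (\<Sum>i<res_deg. emb (c i) * emb (g i * y)) \<in> Fge ?t"
          by (rule Fge_add[OF Fgt_imp_Fge[OF j(2)]])
        moreover have "emb (k - j) + (\<Sum>i<res_deg. emb (c i) * emb (g i * y)) = emb (k' - j)"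
          unfolding k(2) by (simp add: emb_sum)
        ultimately have "emb (k' - j) \<in> Fge ?t" by (simp only:)
        then have "emb (k' - j) \<in> Fgt t" using t'(1) by (intro Fge_imp_Fgt) auto
        then show ?thesis using j(1) by blast
      qed
      moreover have "res_deg * card (insert u U) = res_deg * card U + res_deg"
        using False insert.hyps(1) by simp
      ultimately show ?thesis using K'(1) by (intro exI[of _ K']) (simp only: HOL.simp_thms Ball_def, blast)
    qed
  qed
  from this[OF subset_refl] obtain K where "ideal_chain J K (res_deg * card ?U)" by blast
  then show ?thesis by (rule ideal_chain_from_extend)
qed

text \<open>\<open>v\<close> is the value of the common denominator from \<open>basis_shift\<close>.
  The set of chain lengths is nonempty and bounded, so the supremum defining \<open>colength\<close>
  is a genuine one and inherits both bounds.\<close>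

lemma colength_bounds:
  assumes fin: "\<And>\<tau>. finite {u \<in> Val UNIV. pair_a d a u < \<tau>}"
  shows "\<exists>v\<in>Val UNIV. \<forall>J \<tau>. is_ideal J \<longrightarrow> (\<forall>x. x \<noteq> 0 \<longrightarrow> \<tau> \<le> W (emb x) \<longrightarrow> x \<in> J) \<longrightarrow>
    res_deg * card {u \<in> (\<lambda>u i. u i + v i) ` Val UNIV. pair_a d a u < \<tau> \<and> u \<notin> Val J} \<le> colength J \<and>
    colength J \<le> res_deg * card {u \<in> Val UNIV. pair_a d a u < \<tau> \<and> u \<notin> (\<lambda>u i. u i + v i) ` Val J}"
proof -
  obtain b g where b: "b \<noteq> 0"
    and g: "\<And>y i. y \<noteq> 0 \<Longrightarrow> i < res_deg \<Longrightarrow> emb (g i * y) \<in> Fge (W (emb (b * y)))"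
      "\<And>y. y \<noteq> 0 \<Longrightarrow> indep (W (emb (b * y))) (\<lambda>i. emb (g i * y)) {..<res_deg}"
    using basis_shift by blast
  let ?v = "\<nu> (emb b)"
  have "res_deg * card {u \<in> (\<lambda>u i. u i + ?v i) ` Val UNIV. pair_a d a u < \<tau> \<and> u \<notin> Val J} \<le> colength J \<and>
    colength J \<le> res_deg * card {u \<in> Val UNIV. pair_a d a u < \<tau> \<and> u \<notin> (\<lambda>u i. u i + ?v i) ` Val J}"
    if J: "is_ideal J" "\<And>x. x \<noteq> 0 \<Longrightarrow> \<tau> \<le> W (emb x) \<Longrightarrow> x \<in> J" for J \<tau>
  proof -
    let ?N = "{n. ideal_chain_from J n}"
    have up: "n \<le> res_deg * card {u \<in> Val UNIV. pair_a d a u < \<tau> \<and> u \<notin> (\<lambda>u i. u i + ?v i) ` Val J}"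
      if "n \<in> ?N" for n
      using that by (intro ideal_chain_length_le[OF fin J b g]) auto
    obtain n where n: "n \<in> ?N"
      "res_deg * card {u \<in> (\<lambda>u i. u i + ?v i) ` Val UNIV. pair_a d a u < \<tau> \<and> u \<notin> Val J} \<le> n"
      using ideal_chain_length_ge[OF fin J(1) b g] by blast
    have "n \<le> Sup ?N" using up by (intro cSup_upper n(1) bdd_aboveI)
    moreover have "Sup ?N \<le> res_deg * card {u \<in> Val UNIV. pair_a d a u < \<tau> \<and> u \<notin> (\<lambda>u i. u i + ?v i) ` Val J}"
      using n(1) up by (intro cSup_least) auto
    ultimately show ?thesis unfolding colength_def using n(2) by linarith
  qed
  moreover have "?v \<in> Val UNIV" unfolding Val_def using b by blast
  ultimately show ?thesis by (intro bexI[of _ ?v] allI impI) blast+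
qed

section \<open>Elements of large value and Frobenius powers\<close>

lemma max_ideal_finite_gen: "\<exists>F. finite F \<and> m = ideal_gen F"
  using loc is_ideal_m unfolding local_ring_with_max_def noetherian_ring_def by blast

text \<open>Condition (iv) puts elements of large value into a power of \<open>m\<close>, and
  \<open>ideal_pow_gen_subset\<close> puts that power into \<open>K\<close>. The threshold is linear
  in \<open>N\<close>, as required when \<open>N\<close> grows with \<open>p ^ e\<close>.\<close>

lemma deep_in_ideal:
  "\<exists>\<kappa>>0. \<forall>F K N x. finite F \<longrightarrow> m = ideal_gen F \<longrightarrow> is_ideal K \<longrightarrow> (\<forall>g\<in>F. g ^ N \<in> K) \<longrightarrow> 0 < N \<longrightarrow>
     x \<noteq> 0 \<longrightarrow> (real (card F) + 1) * real N * \<kappa> \<le> W (emb x) \<longrightarrow> x \<in> K"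
proof -
  obtain \<kappa> where \<kappa>: "0 < \<kappa>" "\<And>n x. x \<noteq> 0 \<Longrightarrow> real n * \<kappa> \<le> W (emb x) \<Longrightarrow> x \<in> ideal_pow m n"
    using deep_in_ideal_pow by blast
  have "x \<in> K" if F: "finite F" "m = ideal_gen F" and K: "is_ideal K" "\<forall>g\<in>F. g ^ N \<in> K" and N: "0 < N"
    and x: "x \<noteq> 0" "(real (card F) + 1) * real N * \<kappa> \<le> W (emb x)" for F K N x
  proof -
    have "real (card F * N + 1) \<le> (real (card F) + 1) * real N"
      using N by (simp add: distrib_right)
    then have "real (card F * N + 1) * \<kappa> \<le> (real (card F) + 1) * real N * \<kappa>"
      using \<kappa>(1) by (intro mult_right_mono) auto
    then have "x \<in> ideal_pow m (card F * N + 1)" using x by (intro \<kappa>(2)) linarith+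
    moreover have "ideal_pow m (card F * N + 1) \<subseteq> K"
      unfolding F(2) using K by (intro ideal_pow_gen_subset[OF F(1)]) auto
    ultimately show ?thesis by blast
  qed
  then show ?thesis using \<kappa>(1) by (intro exI[of _ \<kappa>]) blast
qed

lemma p_family_power:
  assumes "p_family p I" "x \<in> I e"
  shows "x ^ (p ^ k) \<in> I (e + k)"
proof (induction k)
  case (Suc k)
  then have "(x ^ p ^ k) ^ p \<in> {x ^ p | x. x \<in> I (e + k)}" by blast
  then have "(x ^ p ^ k) ^ p \<in> frob_pow p (I (e + k))"
    unfolding frob_pow_def by (rule subsetD[OF ideal_gen_superset])
  moreover have "frob_pow p (I (e + k)) \<subseteq> I (Suc (e + k))"
    using assms(1) unfolding p_family_def by blast
  ultimately have "(x ^ p ^ k) ^ p \<in> I (e + Suc k)" by auto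
  then show ?case by (simp add: mult.commute flip: power_mult)
qed (use assms in simp)

text \<open>Generators of \<open>m\<close> have their \<open>N\<close>-th power in
  \<open>I 0\<close>, hence their \<open>N * p ^ e\<close>-th power in \<open>I e\<close>, and
  \<open>deep_in_ideal\<close> applies.\<close>

lemma deep_in_p_family:
  assumes I: "p_family p I" and rad: "m \<subseteq> radical (I 0)" and p: "1 < p"
  shows "\<exists>c>0. \<forall>e x. x \<noteq> 0 \<longrightarrow> c * real p ^ e \<le> W (emb x) \<longrightarrow> x \<in> I e"
proof -
  obtain \<kappa> where \<kappa>: "0 < \<kappa>" and deep: "\<And>F K N x. finite F \<Longrightarrow> m = ideal_gen F \<Longrightarrow> is_ideal K \<Longrightarrow>
     \<forall>g\<in>F. g ^ N \<in> K \<Longrightarrow> 0 < N \<Longrightarrow> x \<noteq> 0 \<Longrightarrow> (real (card F) + 1) * real N * \<kappa> \<le> W (emb x) \<Longrightarrow> x \<in> K"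
    using deep_in_ideal by blast
  obtain F where F: "finite F" "m = ideal_gen F" using max_ideal_finite_gen by blast
  have idI: "is_ideal (I e)" for e using I unfolding p_family_def by blast
  have "F \<subseteq> radical (I 0)" using rad ideal_gen_superset[of F] F(2) by blast
  then have "\<forall>g\<in>F. \<exists>n. g ^ n \<in> I 0" unfolding radical_def by blast
  from bchoice[OF this] obtain h where h: "\<forall>g\<in>F. g ^ h g \<in> I 0" by blast
  \<comment> \<open>The sum dominates each exponent \<open>h g\<close>, and \<open>Suc\<close> makes
    \<open>N\<close> positive even if all exponents vanish.\<close>
  define N where "N = Suc (sum h F)"
  have gN: "g ^ N \<in> I 0" if "g \<in> F" for g
  proof -
    have "h g \<le> N" unfolding N_def using member_le_sum[of g F h] that F(1) by simp
    then have "g ^ N = g ^ (N - h g) * g ^ h g" by (simp flip: power_add)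
    then show ?thesis using h that is_idealD(3)[OF idI] by simp
  qed
  have "x \<in> I e" if "x \<noteq> 0" "(real (card F) + 1) * real N * \<kappa> * real p ^ e \<le> W (emb x)" for e x
  proof (rule deep[OF F idI[of e], of "N * p ^ e"])
    show "\<forall>g\<in>F. g ^ (N * p ^ e) \<in> I e"
      using p_family_power[OF I gN, of _ e] by (simp add: power_mult)
    show "0 < N * p ^ e" using p by (simp add: N_def)
    show "(real (card F) + 1) * real (N * p ^ e) * \<kappa> \<le> W (emb x)"
      using that(2) by (simp add: mult_ac)
  qed (rule that(1))
  moreover have "0 < (real (card F) + 1) * real N * \<kappa>"
    using \<kappa> by (intro mult_pos_pos) (simp_all add: N_def del: of_nat_sum)
  ultimately show ?thesis by (intro exI[of _ "(real (card F) + 1) * real N * \<kappa>"]) blast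
qed

text \<open>This is the case \<open>N = q\<close> of \<open>deep_in_ideal\<close>, as the q-th
  powers of the generators lie in the Frobenius power.\<close>

lemma deep_in_frob_pow:
  "\<exists>\<kappa>>0. \<forall>q x. 0 < q \<longrightarrow> x \<noteq> 0 \<longrightarrow> \<kappa> * real q \<le> W (emb x) \<longrightarrow> x \<in> frob_pow q m"
proof -
  obtain \<kappa> where \<kappa>: "0 < \<kappa>" and deep: "\<And>F K N x. finite F \<Longrightarrow> m = ideal_gen F \<Longrightarrow> is_ideal K \<Longrightarrow>
     \<forall>g\<in>F. g ^ N \<in> K \<Longrightarrow> 0 < N \<Longrightarrow> x \<noteq> 0 \<Longrightarrow> (real (card F) + 1) * real N * \<kappa> \<le> W (emb x) \<Longrightarrow> x \<in> K"
    using deep_in_ideal by blast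
  obtain F where F: "finite F" "m = ideal_gen F" using max_ideal_finite_gen by blast
  have Fm: "F \<subseteq> m" unfolding F(2) by (rule ideal_gen_superset)
  have "x \<in> frob_pow q m" if "0 < q" "x \<noteq> 0" "(real (card F) + 1) * \<kappa> * real q \<le> W (emb x)" for q x
  proof (rule deep[OF F _ _ that(1,2)])
    show "is_ideal (frob_pow q m)" unfolding frob_pow_def by (rule is_ideal_ideal_gen)
    show "\<forall>g\<in>F. g ^ q \<in> frob_pow q m"
    proof
      fix g assume "g \<in> F"
      then have "g ^ q \<in> {x ^ q | x. x \<in> m}" using Fm by blast
      then show "g ^ q \<in> frob_pow q m" unfolding frob_pow_def by (rule subsetD[OF ideal_gen_superset])
    qed
    show "(real (card F) + 1) * real q * \<kappa> \<le> W (emb x)" using that(3) by (simp add: mult_ac)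
  qed
  moreover have "0 < (real (card F) + 1) * \<kappa>" using \<kappa> by (simp add: add_nonneg_pos)
  ultimately show ?thesis by (intro exI[of _ "(real (card F) + 1) * \<kappa>"]) blast
qed

text \<open>Values on \<open>m\<close> are positive and finitely many lie below 1, so some \<delta>
  bounds them away from 0. Then q-th powers have values at least \<open>\<delta> * q\<close>, and
  elements with this bound form an ideal.\<close>

lemma frob_pow_value_ge:
  assumes fin: "\<And>\<tau>. finite {u \<in> Val UNIV. pair_a d a u < \<tau>}"
  shows "\<exists>\<delta>>0. \<forall>q. \<forall>x\<in>frob_pow q m. emb x \<in> Fge (\<delta> * real q)"
proof -
  \<comment> \<open>The element 1 keeps the set nonempty and covers values at least 1; 0 is removed
    as the value of the units.\<close>
  let ?D = "insert 1 (pair_a d a ` {u \<in> Val UNIV. pair_a d a u < 1} - {0})"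
  have finD: "finite ?D" using fin[of 1] by simp
  define \<delta> where "\<delta> = Min ?D"
  have "0 < z" if "z \<in> ?D" for z using that Val_nonneg by force
  then have \<delta>: "0 < \<delta>" unfolding \<delta>_def using finD by (subst Min_gr_iff) auto
  have val: "\<delta> \<le> W (emb x)" if "x \<in> m" "x \<noteq> 0" for x
  proof (cases "W (emb x) < 1")
    case True
    have "0 < W (emb x)" using that unfolding m_iff Fgt_def by simp
    moreover have "\<nu> (emb x) \<in> Val UNIV" unfolding Val_def using that by blast
    ultimately have "W (emb x) \<in> ?D" using True by (auto simp: W_def)
    then show ?thesis unfolding \<delta>_def using finD by (intro Min_le)
  next
    case False
    have "\<delta> \<le> 1" unfolding \<delta>_def using finD by (intro Min_le) auto
    then show ?thesis using False by linarith
  qed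
  have "emb x \<in> Fge (\<delta> * real q)" if "x \<in> frob_pow q m" for q x
  proof -
    let ?K = "{x. emb x \<in> Fge (\<delta> * real q)}"
    have "is_ideal ?K" unfolding is_ideal_def by (auto intro: Fge_add emb_mult_Fge)
    moreover have "emb (x ^ q) \<in> Fge (\<delta> * real q)" if "x \<in> m" for x
    proof (cases "x = 0")
      case False
      have "W (emb (x ^ q)) = real q * W (emb x)"
        using nu_power[of "emb x" q] False by (simp add: W_def emb_power pair_a_scale)
      moreover have "\<delta> * real q \<le> real q * W (emb x)"
        using val[OF that False] by (subst mult.commute) (intro mult_left_mono, auto)
      ultimately show ?thesis by (simp add: Fge_def)
    next
      case True
      \<comment> \<open>For \<open>q = 0\<close> the power \<open>0 ^ 0\<close> is 1, of value 0,
        which meets the bound.\<close>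
      then show ?thesis by (cases "q = 0") (auto simp: Fge_def)
    qed
    ultimately have "frob_pow q m \<subseteq> ?K" unfolding frob_pow_def by (intro ideal_gen_least) auto
    then show ?thesis using that by blast
  qed
  then show ?thesis using \<delta> by blast
qed

section \<open>Positivity of the volume\<close>

lemma volume_pos_iff:
  assumes p: "1 < p" and I: "p_family p I" and rad: "m \<subseteq> radical (I 0)"
  shows "volume p d I > 0 \<longleftrightarrow> (\<exists>e0. \<forall>e. I (e + e0) \<subseteq> frob_pow (p ^ e) m)"
proof -
  obtain \<epsilon> where "weighted_monoid d a (Val UNIV) \<epsilon>" using weighted by blast
  then interpret weighted_monoid d a "Val UNIV" \<epsilon> .
  have idI: "is_ideal (I e)" for e using I unfolding p_family_def by blast
  define T where "T e = Val (I e)" for e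
  have Tsub: "T e \<subseteq> Val UNIV" for e unfolding T_def by (rule Val_mono) simp
  have T: "p_system p T"
    unfolding p_system_def
  proof (intro conjI allI ballI Tsub)
    fix e u v assume "u \<in> T e" "v \<in> Val UNIV"
    then show "(\<lambda>i. u i + v i) \<in> T e" unfolding T_def by (rule Val_add[OF idI])
  next
    fix e u assume "u \<in> T e"
    then obtain x where x: "x \<in> I e" "x \<noteq> 0" "u = \<nu> (emb x)" unfolding T_def Val_def by blast
    have "(\<lambda>i. int p * u i) = \<nu> (emb (x ^ p))" using nu_power[of "emb x" p] x by (simp add: emb_power)
    moreover have "x ^ p \<in> I (Suc e)" using p_family_power[OF I x(1), of 1] by simp
    ultimately show "(\<lambda>i. int p * u i) \<in> T (Suc e)" unfolding T_def Val_def using x(2) by auto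
  qed
  obtain c0 where c0: "0 < c0" "\<And>e x. x \<noteq> 0 \<Longrightarrow> c0 * real p ^ e \<le> W (emb x) \<Longrightarrow> x \<in> I e"
    using deep_in_p_family[OF I rad p] by blast
  obtain \<delta> where \<delta>: "0 < \<delta>" "\<And>q x. x \<in> frob_pow q m \<Longrightarrow> emb x \<in> Fge (\<delta> * real q)"
    using frob_pow_value_ge[OF finite_below] by blast
  obtain \<kappa> where \<kappa>: "0 < \<kappa>" "\<And>q x. 0 < q \<Longrightarrow> x \<noteq> 0 \<Longrightarrow> \<kappa> * real q \<le> W (emb x) \<Longrightarrow> x \<in> frob_pow q m"
    using deep_in_frob_pow by blast
  \<comment> \<open>Above \<open>c0 * p ^ e\<close> every element lies in \<open>I e\<close>;
    \<open>c \<ge> \<delta>\<close> also keeps the gap used in the converse direction below the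
    counting threshold.\<close>
  define c where "c = max c0 \<delta>"
  have c: "0 < c" "\<delta> \<le> c" using c0(1) unfolding c_def by auto
  have big: "x \<in> I e" if "x \<noteq> 0" "c * real p ^ e \<le> W (emb x)" for e x
  proof (rule c0(2)[OF that(1)])
    have "c0 * real p ^ e \<le> c * real p ^ e" unfolding c_def by (intro mult_right_mono) auto
    then show "c0 * real p ^ e \<le> W (emb x)" using that(2) by linarith
  qed
  obtain v where v: "v \<in> Val UNIV" and len: "\<And>J \<tau>. is_ideal J \<Longrightarrow> \<forall>x. x \<noteq> 0 \<longrightarrow> \<tau> \<le> W (emb x) \<longrightarrow> x \<in> J \<Longrightarrow>
    res_deg * card {u \<in> (\<lambda>u i. u i + v i) ` Val UNIV. L u < \<tau> \<and> u \<notin> Val J} \<le> colength J \<and>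
    colength J \<le> res_deg * card {u \<in> Val UNIV. L u < \<tau> \<and> u \<notin> (\<lambda>u i. u i + v i) ` Val J}"
    using colength_bounds[OF finite_below] by blast
  define S where "S = Val (UNIV :: 'a set)"
  define D where "D e = (real (cnt S (c * real p ^ e)) - real (cnt (T e) (c * real p ^ e))) / real (p ^ e) ^ d" for e
  obtain K where K: "0 < K"
    "\<And>q s t. 1 \<le> q \<Longrightarrow> t \<le> s \<Longrightarrow> s \<le> c * q \<Longrightarrow> finite {u \<in> S. t \<le> L u \<and> L u < s}"
    "\<And>q s t. 1 \<le> q \<Longrightarrow> t \<le> s \<Longrightarrow> s \<le> c * q \<Longrightarrow>
      real (card {u \<in> S. t \<le> L u \<and> L u < s}) \<le> K * q ^ (d - 1) * (s - t + 1)"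
    using slab_count[OF c(1)] unfolding S_def by blast
  let ?sh = "\<lambda>A. (\<lambda>u i. u i + v i) ` A"
  have Lv: "0 \<le> L v" using L_nonneg[OF v] .
  have shS: "?sh S \<subseteq> S" using S_add[OF _ v] unfolding S_def by auto
  have shT: "?sh (T e) \<subseteq> S" for e using shS Tsub[of e] unfolding S_def by blast
  have diff: "real (card {u \<in> A. L u < t \<and> u \<notin> B}) \<ge> real (cnt A t) - real (cnt B t)"
    if "A \<subseteq> S" "B \<subseteq> S" for A B t
  proof -
    have "{u \<in> A. L u < t} \<subseteq> {u \<in> A. L u < t \<and> u \<notin> B} \<union> {u \<in> B. L u < t}" by blast
    moreover have "finite ({u \<in> A. L u < t \<and> u \<notin> B} \<union> {u \<in> B. L u < t})"
      by (rule finite_subset[OF _ finite_below[of t]]) (use that in \<open>auto simp: S_def\<close>)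
    ultimately have "cnt A t \<le> card ({u \<in> A. L u < t \<and> u \<notin> B} \<union> {u \<in> B. L u < t})"
      unfolding cnt_def by (intro card_mono)
    also have "\<dots> \<le> card {u \<in> A. L u < t \<and> u \<notin> B} + cnt B t" unfolding cnt_def by (rule card_Un_le)
    finally show ?thesis by linarith
  qed
  have diff_eq: "real (card {u \<in> S. L u < t \<and> u \<notin> B}) = real (cnt S t) - real (cnt B t)"
    if "B \<subseteq> S" for B t
  proof -
    have "{u \<in> S. L u < t \<and> u \<notin> B} = {u \<in> S. L u < t} - {u \<in> B. L u < t}" using that by auto
    moreover have "{u \<in> B. L u < t} \<subseteq> {u \<in> S. L u < t}" using that by auto
    moreover have "finite {u \<in> S. L u < t}" using finite_below unfolding S_def .
    ultimately show ?thesis unfolding cnt_def by (simp add: card_Diff_subset finite_subset card_mono of_nat_diff)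
  qed
  define col where "col e = real (colength (I e)) / real (p ^ e) ^ d" for e
  \<comment> \<open>By \<open>colength_bounds\<close> the colength is \<open>res_deg\<close> times a
    point count up to a translation by \<open>v\<close>. This moves a threshold by
    \<open>L v\<close>, at the cost of a slab of \<open>O(q ^ (d - 1))\<close> points.\<close>
  have close: "\<bar>col e - real res_deg * D e\<bar> \<le> real res_deg * (K * (L v + 1)) * (1 / real p) ^ e" for e
  proof -
    let ?q = "real p ^ e"
    let ?s = "c * ?q"
    let ?sl = "real (card {u \<in> S. ?s - L v \<le> L u \<and> L u < ?s})"
    let ?d = "real (cnt S ?s) - real (cnt (T e) ?s)"
    have q: "1 \<le> ?q" using p by simp
    have "?sl \<le> K * ?q ^ (d - 1) * (?s - (?s - L v) + 1)" using q Lv by (intro K(3)) auto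
    then have sl: "?sl \<le> K * (L v + 1) * ?q ^ (d - 1)" by (simp add: mult_ac)
    have slA: "real (cnt A ?s) \<le> real (cnt A (?s - L v)) + ?sl" if "A \<subseteq> S" for A
      using cnt_slab[of A "?s - L v" ?s] that Lv unfolding S_def by simp
    have l: "res_deg * card {u \<in> ?sh S. L u < ?s \<and> u \<notin> T e} \<le> colength (I e)"
      "colength (I e) \<le> res_deg * card {u \<in> S. L u < ?s \<and> u \<notin> ?sh (T e)}"
      using len[OF idI[of e], of ?s] big[of _ e] unfolding S_def T_def by auto
    have "real (colength (I e)) \<le> real res_deg * real (card {u \<in> S. L u < ?s \<and> u \<notin> ?sh (T e)})"
      using l(2) by (simp flip: of_nat_mult)
    also have "\<dots> = real res_deg * (real (cnt S ?s) - real (cnt (T e) (?s - L v)))"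
      by (simp only: diff_eq[OF shT] cnt_shift)
    also have "\<dots> \<le> real res_deg * (?d + K * (L v + 1) * ?q ^ (d - 1))"
      using slA[of "T e"] sl Tsub unfolding S_def by (intro mult_left_mono) auto
    finally have up: "real (colength (I e)) \<le> real res_deg * (?d + K * (L v + 1) * ?q ^ (d - 1))" .
    have "real res_deg * (?d - K * (L v + 1) * ?q ^ (d - 1)) \<le> real res_deg * (real (cnt S (?s - L v)) - real (cnt (T e) ?s))"
      using slA[of S] sl by (intro mult_left_mono) auto
    also have "\<dots> \<le> real res_deg * real (card {u \<in> ?sh S. L u < ?s \<and> u \<notin> T e})"
      using diff[OF shS, of "T e" ?s] Tsub[of e] unfolding S_def cnt_shift by (intro mult_left_mono) auto
    also have "\<dots> \<le> real (colength (I e))" using l(1) by (simp flip: of_nat_mult)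
    finally have lo: "real res_deg * (?d - K * (L v + 1) * ?q ^ (d - 1)) \<le> real (colength (I e))" .
    have "\<bar>real (colength (I e)) - real res_deg * ?d\<bar> \<le> real res_deg * (K * (L v + 1)) * ?q ^ (d - 1)"
      using up lo by (simp add: abs_le_iff algebra_simps)
    then have "\<bar>real (colength (I e)) - real res_deg * ?d\<bar> / ?q ^ d \<le> real res_deg * (K * (L v + 1)) * ?q ^ (d - 1) / ?q ^ d"
      using q by (intro divide_right_mono) auto
    moreover have "col e - real res_deg * D e = (real (colength (I e)) - real res_deg * ?d) / ?q ^ d"
      by (simp add: col_def D_def diff_divide_distrib right_diff_distrib)
    moreover have "?q ^ (d - 1) / ?q ^ d = (1 / real p) ^ e"
      using q p dim_pos by (cases d) (simp_all add: power_one_over divide_simps)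
    ultimately show ?thesis using q by (simp add: abs_divide flip: times_divide_eq_right)
  qed
  have convD: "convergent D"
  proof -
    have "convergent (\<lambda>e. real (cnt S (c * real p ^ e)) / real (p ^ e) ^ d - real (cnt (T e) (c * real p ^ e)) / real (p ^ e) ^ d)"
      unfolding S_def
      by (intro convergent_diff cnt_ratio_convergent[OF p_system_const p c(1)] cnt_ratio_convergent[OF T p c(1)])
    then show ?thesis unfolding D_def by (simp add: diff_divide_distrib)
  qed
  then obtain l where l: "D \<longlonglongrightarrow> l" unfolding convergent_def by blast
  have "(\<lambda>e. col e - real res_deg * D e) \<longlonglongrightarrow> 0"
  proof (rule tendsto_0_le)
    show "(\<lambda>e. (1 / real p) ^ e) \<longlonglongrightarrow> 0" using p by (intro LIMSEQ_realpow_zero) auto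
    show "\<forall>\<^sub>F e in sequentially. norm (col e - real res_deg * D e)
        \<le> norm ((1 / real p) ^ e) * (real res_deg * (K * (L v + 1)))"
      using close by (intro always_eventually allI) (simp add: mult.commute)
  qed
  then have "(\<lambda>e. (col e - real res_deg * D e) + real res_deg * D e) \<longlonglongrightarrow> 0 + real res_deg * l"
    by (intro tendsto_add tendsto_mult tendsto_const l)
  then have "col \<longlonglongrightarrow> real res_deg * l" by simp
  \<comment> \<open>Convergence is now established, so the \<open>lim\<close> in
    \<open>volume\<close> has a determined value: the residue degree times the limit of the
    normalised number of missing points.\<close>
  then have vol: "volume p d I = real res_deg * l"
    unfolding volume_def col_def by (rule limI)
  show ?thesis
  proof
    assume "volume p d I > 0"
    then have lpos: "0 < l" using vol by (simp add: zero_less_mult_iff)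
    show "\<exists>e0. \<forall>e. I (e + e0) \<subseteq> frob_pow (p ^ e) m"
    proof (rule ccontr)
      assume contr: "\<not> ?thesis"
      \<comment> \<open>An element of \<open>I (e + j)\<close> outside the Frobenius power is
        nonzero and, by the choice of \<kappa>, has value below \<open>\<kappa> * p ^ e\<close>;
        this is the point that \<open>cnt_diff_upper\<close> asks for.\<close>
      have "\<exists>e. \<exists>w\<in>T (e + j). L w < \<kappa> * real p ^ e" for j
      proof -
        obtain e x where x: "x \<in> I (e + j)" "x \<notin> frob_pow (p ^ e) m" using contr by blast
        have "0 \<in> frob_pow (p ^ e) m" unfolding frob_pow_def by (rule is_idealD(1)[OF is_ideal_ideal_gen])
        then have "x \<noteq> 0" using x(2) by auto
        then have "W (emb x) < \<kappa> * real p ^ e" using \<kappa>(2)[of "p ^ e" x] x(2) p by force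
        moreover have "\<nu> (emb x) \<in> T (e + j)" unfolding T_def Val_def using x(1) \<open>x \<noteq> 0\<close> by blast
        ultimately show ?thesis unfolding W_def by blast
      qed
      then have "l \<le> 0" using l unfolding D_def S_def by (intro cnt_diff_upper[OF T p c(1)])
      then show False using lpos by simp
    qed
  next
    assume "\<exists>e0. \<forall>e. I (e + e0) \<subseteq> frob_pow (p ^ e) m"
    then obtain e0 where e0: "\<And>e. I (e + e0) \<subseteq> frob_pow (p ^ e) m" by blast
    \<comment> \<open>At level \<open>e = k + e0\<close> the nonzero elements of the ideal have
      values at least \<open>\<delta> * p ^ k\<close>, which equals
      \<open>?\<delta> * p ^ e\<close>.\<close>
    let ?\<delta> = "\<delta> / real p ^ e0"
    have "0 < ?\<delta>" using \<delta>(1) p by simp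
    then obtain \<eta> j where \<eta>: "0 < \<eta>" "\<And>e. j \<le> e \<Longrightarrow> \<eta> \<le> real (cnt S (?\<delta> * real p ^ e)) / real (p ^ e) ^ d"
      using cnt_S_lower[OF p] unfolding S_def by blast
    have "\<eta> \<le> D e" if e: "j + e0 \<le> e" for e
    proof -
      let ?t = "?\<delta> * real p ^ e"
      obtain k where k: "e = k + e0" using e by (metis add_leE le_add_diff_inverse2)
      have t: "?t = \<delta> * real p ^ k" using p by (simp add: k power_add)
      have le: "?t \<le> c * real p ^ e"
      proof -
        have "?\<delta> \<le> \<delta>" using \<delta>(1) p by (simp add: divide_le_eq_1 pos_divide_le_eq)
        then show ?thesis using c(2) by (intro mult_right_mono) auto
      qed
      \<comment> \<open>All points of \<open>S\<close> below \<open>?t\<close> are missing from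
        \<open>T e\<close>, and by \<open>cnt_S_lower\<close> they amount to a fixed proportion of
        \<open>(p ^ e) ^ d\<close>.\<close>
      have "{u \<in> S. L u < ?t} \<subseteq> {u \<in> S. L u < c * real p ^ e \<and> u \<notin> T e}"
      proof clarify
        fix u assume u: "u \<in> S" "L u < ?t"
        have "u \<notin> T e"
        proof
          assume "u \<in> T e"
          then obtain x where x: "x \<in> I e" "x \<noteq> 0" "u = \<nu> (emb x)" unfolding T_def Val_def by blast
          then have "emb x \<in> Fge (\<delta> * real (p ^ k))" using \<delta>(2) e0[of k] k by blast
          then have "?t \<le> L u" using x(2,3) t by (simp add: Fge_def W_def)
          then show False using u(2) by simp
        qed
        then show "L u < c * real p ^ e \<and> u \<notin> T e" using u(2) le by linarith
      qed
      moreover have "finite {u \<in> S. L u < c * real p ^ e \<and> u \<notin> T e}"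
        by (rule finite_subset[OF _ finite_below[of "c * real p ^ e"]]) (auto simp: S_def)
      ultimately have "cnt S ?t \<le> card {u \<in> S. L u < c * real p ^ e \<and> u \<notin> T e}"
        unfolding cnt_def by (intro card_mono)
      then have "real (cnt S ?t) \<le> real (cnt S (c * real p ^ e)) - real (cnt (T e) (c * real p ^ e))"
        using diff_eq[of "T e" "c * real p ^ e"] Tsub[of e] by (simp add: S_def)
      then have "real (cnt S ?t) / real (p ^ e) ^ d \<le> D e"
        unfolding D_def by (intro divide_right_mono) auto
      then show ?thesis using \<eta>(2)[of e] e by linarith
    qed
    then have "\<eta> \<le> l" by (intro LIMSEQ_le_const[OF l] exI[of _ "j + e0"]) simp
    then show "volume p d I > 0" unfolding vol using \<eta>(1) res_deg_pos by simp
  qed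
qed

end

theorem mainTheorem5:
  fixes m :: "'a::idom set" and I :: "nat \<Rightarrow> 'a set" and p d :: nat and a :: "nat \<Rightarrow> real"
  assumes "prime p" and "CHAR('a) = p"
    and "local_ring_with_max m"
    and "krull_dim_eq TYPE('a) d"
    and "rat_lin_indep d a"
    and "ok_domain d a m"
    and "p_family p I"
    and "\<forall>e. m_primary m (I e)"
  shows "volume p d I > 0 \<longleftrightarrow> (\<exists>e0. \<forall>e. I (e + e0) \<subseteq> frob_pow (p ^ e) m)"
proof -
  obtain \<nu> where "ok_valuation d a m \<nu>" using assms(6) unfolding ok_domain_def by blast
  then interpret ok_local_domain m d a \<nu> using assms by unfold_locales
  show ?thesis
  proof (rule volume_pos_iff)
    show "1 < p" using assms(1) by (rule prime_gt_1_nat)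
    show "p_family p I" by fact
    show "m \<subseteq> radical (I 0)" using assms(8) unfolding m_primary_def by blast
  qed
qed

end
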